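(* $ST(2)=6$. That is, every regular $2$-balanced $c$-partite tournament with $c\ge 6$ has a strong partition, and $6$ is the smallest integer with this property (there is a regular $2$-balanced $5$-partite tournament with no strong partition).
   Context: For $c\ge 3$, a $c$-partite tournament is a digraph obtained from a complete $c$-partite graph by orienting each edge; it is $r$-balanced if every partite set has exactly $r$ vertices, and regular if every vertex has in-degree equal to its out-degree. A partition of an $r$-balanced $c$-partite tournament into maximal tournaments is a spanning subgraph consisting of $r$ pairwise vertex-disjoint tournaments of order $c$ (each using exactly one vertex from each partite set). Such a partition is a strong partition if each of its $r$ tournaments is strongly connected. $ST(r)$ denotes the minimum integer $c'$ such that every regular $r$-balanced $c$-partite tournament with $c\ge c'$ has a strong partition. *)

theory Defs
  imports "Graph_Theory.Graph_Theory" "HOL-Library.Disjoint_Sets"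
begin

definition tournament :: "'a pair_pre_digraph \<Rightarrow> bool" where
  "tournament T \<longleftrightarrow> pair_digraph T \<and>
     (\<forall>u\<in>pverts T. \<forall>v\<in>pverts T. u \<noteq> v \<longrightarrow> ((u, v) \<in> parcs T \<longleftrightarrow> (v, u) \<notin> parcs T))"

text \<open>
  The partite sets are carried along as the explicit family \<open>\<P>\<close>. Each edge of the complete
  multipartite graph is oriented in exactly one direction, and there are no further arcs.
\<close>

definition multipartite_tournament ::
    "nat \<Rightarrow> 'a pair_pre_digraph \<Rightarrow> 'a set set \<Rightarrow> bool" where
  "multipartite_tournament c D \<P> \<longleftrightarrow>
     c \<ge> 3 \<and> pair_digraph D \<and> partition_on (pverts D) \<P> \<and> card \<P> = c \<and>
     (\<forall>P\<in>\<P>. \<forall>u\<in>P. \<forall>v\<in>P. (u, v) \<notin> parcs D) \<and>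
     (\<forall>P\<in>\<P>. \<forall>Q\<in>\<P>. P \<noteq> Q \<longrightarrow>
        (\<forall>u\<in>P. \<forall>v\<in>Q. (u, v) \<in> parcs D \<longleftrightarrow> (v, u) \<notin> parcs D))"

definition balanced :: "nat \<Rightarrow> 'a set set \<Rightarrow> bool" where
  "balanced r \<P> \<longleftrightarrow> (\<forall>P\<in>\<P>. card P = r)"

definition regular :: "'a pair_pre_digraph \<Rightarrow> bool" where
  "regular D \<longleftrightarrow> (\<forall>v\<in>pverts D. in_degree (with_proj D) v = out_degree (with_proj D) v)"

definition regular_balanced_multipartite_tournament ::
    "nat \<Rightarrow> nat \<Rightarrow> 'a pair_pre_digraph \<Rightarrow> 'a set set \<Rightarrow> bool" where
  "regular_balanced_multipartite_tournament r c D \<P> \<longleftrightarrow>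
     multipartite_tournament c D \<P> \<and> balanced r \<P> \<and> regular D"

text \<open>The spanning subgraph is given by the set \<open>\<T>\<close> of the tournaments it consists of.\<close>

definition max_tournament_partition ::
    "nat \<Rightarrow> nat \<Rightarrow> 'a pair_pre_digraph \<Rightarrow> 'a set set \<Rightarrow> 'a pair_pre_digraph set \<Rightarrow> bool" where
  "max_tournament_partition r c D \<P> \<T> \<longleftrightarrow>
     card \<T> = r \<and>
     (\<forall>T\<in>\<T>. subgraph (with_proj T) (with_proj D) \<and> tournament T \<and> card (pverts T) = c \<and>
        (\<forall>P\<in>\<P>. card (pverts T \<inter> P) = 1)) \<and>
     (\<forall>S\<in>\<T>. \<forall>T\<in>\<T>. S \<noteq> T \<longrightarrow> pverts S \<inter> pverts T = {}) \<and>
     (\<Union>T\<in>\<T>. pverts T) = pverts D"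

definition strong_partition ::
    "nat \<Rightarrow> nat \<Rightarrow> 'a pair_pre_digraph \<Rightarrow> 'a set set \<Rightarrow> 'a pair_pre_digraph set \<Rightarrow> bool" where
  "strong_partition r c D \<P> \<T> \<longleftrightarrow>
     max_tournament_partition r c D \<P> \<T> \<and> (\<forall>T\<in>\<T>. strongly_connected (with_proj T))"

text \<open>
  Vertices are drawn from \<^typ>\<open>nat\<close>: every finite digraph is isomorphic to one on natural
  numbers. Note that \<open>LEAST\<close> is only meaningful if some \<open>c'\<close> has the property.
\<close>

definition ST :: "nat \<Rightarrow> nat" where
  "ST r = (LEAST c'. c' \<ge> 3 \<and>
     (\<forall>c\<ge>c'. \<forall>(D :: nat pair_pre_digraph) \<P>.
        regular_balanced_multipartite_tournament r c D \<P> \<longrightarrow> (\<exists>\<T>. strong_partition r c D \<P> \<T>)))"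

end

theory Submission
  imports Defs
begin

text \<open>
  Call a transversal of the partite sets nonstrong if it splits as \<open>A \<union> B\<close> with all arcs going from
  \<open>A\<close> to \<open>B\<close>. There are \<open>2 ^ c\<close> transversals, so if fewer than \<open>2 ^ (c - 1)\<close> of them are nonstrong,
  some transversal and its complement are both strong.

  Nonstrong transversals are counted by weights. In one of them, the in-degrees in \<open>A\<close> sum to
  \<open>|A| (|A| - 1) / 2\<close>, so for a suitable convex decreasing \<open>\<phi>\<close> the sum of
  \<open>\<phi> (in-degree) + \<phi> (out-degree)\<close> over its vertices is at least some \<open>M\<close>. Conversely, regularity
  makes every vertex have as many partite sets consisting of two in-neighbours as of two out-neighbours;
  by convexity the sum of \<open>\<phi> (in-degree)\<close> over the transversals through a fixed vertex is largest
  when there are none, and it is then \<open>\<Sum>k. (c - 1 choose k) * \<phi> k\<close>. For \<open>c \<ge> 8\<close> this double counting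
  suffices. For \<open>c = 6\<close> and \<open>c = 7\<close> the smaller side has at most three vertices, hence contains a
  source or sink of the transversal or is a cyclic triangle. A vertex lies in such a triangle for at
  most four transversals, and for at most \<open>c - 5\<close> of them if it is a source of some transversal.
\<close>

section \<open>Sums over transversals\<close>

text \<open>Stated for an arbitrary family, not only for the partite sets, so that sums over
  transversals can be evaluated by induction on the family.\<close>

definition transversals :: "'a set set \<Rightarrow> 'a set set" where
  "transversals \<Q> = {S. S \<subseteq> \<Union>\<Q> \<and> (\<forall>P\<in>\<Q>. card (S \<inter> P) = 1)}"

lemma transversals_empty [simp]: "transversals {} = {{}}"
  by (auto simp: transversals_def)

lemma finite_transversals:
  assumes "finite (\<Union>\<Q>)"
  shows "finite (transversals \<Q>)"
  by (rule finite_subset[of _ "Pow (\<Union>\<Q>)"]) (use assms in \<open>auto simp: transversals_def\<close>)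

text \<open>Adding \<open>P\<close> to the family means one more free choice: a transversal splits
  uniquely into its part outside \<open>P\<close> and its single element of \<open>P\<close>,
  because \<open>P\<close> is disjoint from the other members.\<close>

lemma sum_transversals_insert:
  assumes fin: "finite P" and disj: "P \<inter> \<Union>\<Q> = {}"
  shows "(\<Sum>S\<in>transversals (insert P \<Q>). g S) = (\<Sum>S\<in>transversals \<Q>. \<Sum>x\<in>P. g (insert x S))"
proof -
  have "(\<Sum>S\<in>transversals (insert P \<Q>). g S) = (\<Sum>(S, x)\<in>transversals \<Q> \<times> P. g (insert x S))"
  proof (rule sum.reindex_bij_witness[where j = "\<lambda>S. (S - P, the_elem (S \<inter> P))"
        and i = "\<lambda>(S, x). insert x S"], goal_cases)
    case (1 S)
    then obtain x where "S \<inter> P = {x}" by (auto simp: transversals_def card_1_singleton_iff)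
    then show ?case by auto
  next
    case (2 S)
    then obtain x where x: "S \<inter> P = {x}" by (auto simp: transversals_def card_1_singleton_iff)
    have "(S - P) \<inter> Q = S \<inter> Q" if "Q \<in> \<Q>" for Q using that disj by auto
    then show ?case using 2 x by (auto simp: transversals_def)
  next
    case (3 b)
    then obtain S x where b: "b = (S, x)" "S \<in> transversals \<Q>" "x \<in> P" by auto
    have "S \<inter> P = {}" using b disj by (auto simp: transversals_def)
    then have *: "insert x S \<inter> P = {x}" "insert x S - P = S" using b by auto
    show ?case unfolding b(1) prod.case * by simp
  next
    case (4 b)
    then obtain S x where b: "b = (S, x)" "S \<in> transversals \<Q>" "x \<in> P" by auto
    have "S \<inter> P = {}" using b disj by (auto simp: transversals_def)
    then have *: "insert x S \<inter> P = {x}" using b by auto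
    have "insert x S \<inter> Q = S \<inter> Q" if "Q \<in> \<Q>" for Q using that disj b by auto
    moreover have "card (insert x S \<inter> P) = 1" by (simp only: *) simp
    ultimately show ?case using b by (auto simp: transversals_def)
  next
    case (5 S)
    then obtain x where "S \<inter> P = {x}" by (auto simp: transversals_def card_1_singleton_iff)
    then have "insert x (S - P) = S" by auto
    with \<open>S \<inter> P = {x}\<close> show ?case by simp
  qed
  then show ?thesis by (simp add: sum.cartesian_product)
qed

text \<open>This is \<open>2 ^ n\<close> times the expected value of \<open>\<phi>\<close> at the
  number of heads in \<open>n\<close> fair coin tosses. A partite set with exactly one in-neighbour
  of a fixed vertex will act as such a toss.\<close>

definition bsum :: "nat \<Rightarrow> (nat \<Rightarrow> nat) \<Rightarrow> nat" where
  "bsum n \<phi> = (\<Sum>k\<le>n. (n choose k) * \<phi> k)"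

lemma bsum_0 [simp]: "bsum 0 \<phi> = \<phi> 0"
  by (simp add: bsum_def)

text \<open>Pascal's rule: the two summands condition on the outcome of one toss.\<close>

lemma bsum_Suc: "bsum (Suc n) \<phi> = bsum n \<phi> + bsum n (\<lambda>k. \<phi> (Suc k))"
proof -
  have "bsum (Suc n) \<phi> = \<phi> 0 + (\<Sum>k\<le>n. (Suc n choose Suc k) * \<phi> (Suc k))"
    unfolding bsum_def by (subst sum.atMost_Suc_shift) simp
  also have "\<dots> = (\<phi> 0 + (\<Sum>k\<le>n. (n choose Suc k) * \<phi> (Suc k))) + bsum n (\<lambda>k. \<phi> (Suc k))"
    by (simp add: bsum_def algebra_simps sum.distrib)
  also have "\<phi> 0 + (\<Sum>k\<le>n. (n choose Suc k) * \<phi> (Suc k)) = (\<Sum>k\<le>Suc n. (n choose k) * \<phi> k)"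
    by (subst sum.atMost_Suc_shift) simp
  also have "\<dots> = bsum n \<phi>" by (simp add: bsum_def)
  finally show ?thesis .
qed

lemma bsum_add: "bsum n (\<lambda>k. f k + g k) = bsum n f + bsum n g"
  by (simp add: bsum_def sum.distrib algebra_simps)

lemma bsum_mono: "(\<And>k. f k \<le> g k) \<Longrightarrow> bsum n f \<le> bsum n g"
  unfolding bsum_def by (intro sum_mono mult_left_mono) auto

lemma bsum_cmult: "bsum n (\<lambda>k. m * \<phi> k) = m * bsum n \<phi>"
  by (simp add: bsum_def sum_distrib_left algebra_simps)

text \<open>Jensen's inequality, two tosses at a time. Two fair tosses have mean 1, so fixing their
  total at 1 does not increase the expectation of a convex function; each factor 4 counts the
  outcomes of two tosses.\<close>

lemma bsum_convex:
  assumes "\<And>k. 2 * \<phi> (Suc k) \<le> \<phi> k + \<phi> (Suc (Suc k))"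
  shows "4 ^ p * bsum n (\<lambda>k. \<phi> (k + p)) \<le> bsum (n + 2 * p) \<phi>"
  using assms
proof (induction p arbitrary: \<phi>)
  case (Suc p)
  let ?\<psi> = "\<lambda>k. \<phi> (Suc k)"
  have "4 ^ Suc p * bsum n (\<lambda>k. \<phi> (k + Suc p)) \<le> 4 * bsum (n + 2 * p) ?\<psi>"
    using Suc.IH[of ?\<psi>] Suc.prems by simp
  \<comment> \<open>Two applications of \<open>bsum_Suc\<close> to the goal produce
    \<open>\<phi>\<close> once, \<open>?\<psi>\<close> twice and the double shift once, so only two
    of the four copies of \<open>?\<psi>\<close> are traded in by convexity.\<close>
  also have "\<dots> = 2 * bsum (n + 2 * p) ?\<psi> + bsum (n + 2 * p) (\<lambda>k. 2 * ?\<psi> k)"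
    by (simp add: bsum_cmult)
  also have "bsum (n + 2 * p) (\<lambda>k. 2 * ?\<psi> k)
      \<le> bsum (n + 2 * p) \<phi> + bsum (n + 2 * p) (\<lambda>k. \<phi> (Suc (Suc k)))"
    unfolding bsum_add[symmetric] by (rule bsum_mono) (rule Suc.prems)
  finally show ?case by (simp add: bsum_Suc)
qed simp

text \<open>\<open>n0\<close>, \<open>n1\<close>, \<open>n2\<close> are the numbers of members of
  \<open>\<Q>\<close> meeting \<open>W\<close> in 0, 1 and 2 points. A member of the first or last
  kind adds a fixed amount to the intersection and doubles the number of choices; one of the middle
  kind is a fair toss. \<open>\<phi>\<close> is quantified inside the conclusion because choosing a
  point of \<open>W\<close> passes to the shifted function in the induction.\<close>

lemma sum_transversals_inter_card:
  assumes "finite \<Q>" "disjoint \<Q>" "\<And>P. P \<in> \<Q> \<Longrightarrow> card P = 2"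
  obtains n0 n1 n2 where "n0 + n1 + n2 = card \<Q>" "n1 + 2 * n2 = card (\<Union>\<Q> \<inter> W)"
    "\<And>\<phi> :: nat \<Rightarrow> nat. (\<Sum>S\<in>transversals \<Q>. \<phi> (card (S \<inter> W))) = 2 ^ (n0 + n2) * bsum n1 (\<lambda>k. \<phi> (k + n2))"
  using assms
proof (induction \<Q> arbitrary: thesis rule: finite_induct)
  case empty
  show ?case by (rule empty.prems(1)[of 0 0 0]) auto
next
  case (insert P \<Q>)
  have disj: "P \<inter> \<Union>\<Q> = {}"
    using insert.prems(2) insert.hyps(2) by (auto simp: disjoint_def pairwise_def disjnt_def)
  have dQ: "disjoint \<Q>" using insert.prems(2) by (simp add: pairwise_insert)
  obtain n0 n1 n2 where n: "n0 + n1 + n2 = card \<Q>" "n1 + 2 * n2 = card (\<Union>\<Q> \<inter> W)"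
    and S: "\<And>\<phi> :: nat \<Rightarrow> nat. (\<Sum>S\<in>transversals \<Q>. \<phi> (card (S \<inter> W))) = 2 ^ (n0 + n2) * bsum n1 (\<lambda>k. \<phi> (k + n2))"
    by (rule insert.IH[OF _ dQ insert.prems(3)[OF insertI2]]) (rule that)
  have cP: "card P = 2" using insert.prems(3) by simp
  have finP: "finite P" using cP by (simp add: card_eq_0_iff card_ge_0_finite)
  have "finite Q" if "Q \<in> \<Q>" for Q
    using insert.prems(3)[of Q] that by (simp add: card_ge_0_finite)
  then have finQ: "finite (\<Union>\<Q>)" using insert.hyps(1) by blast
  have cu: "card (\<Union>(insert P \<Q>) \<inter> W) = card (\<Union>\<Q> \<inter> W) + card (P \<inter> W)"
  proof -
    have "\<Union>(insert P \<Q>) \<inter> W = (\<Union>\<Q> \<inter> W) \<union> (P \<inter> W)" by blast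
    then show ?thesis using disj finP finQ by (simp only:) (rule card_Un_disjoint; blast)
  qed
  have cI: "card (insert x S \<inter> W) = card (S \<inter> W) + (if x \<in> W then 1 else 0)"
    if "S \<in> transversals \<Q>" "x \<in> P" for S x
  proof -
    have "finite S" "x \<notin> S"
      using that disj finQ by (auto simp: transversals_def intro: finite_subset)
    then show ?thesis by simp
  qed
  have step: "(\<Sum>S\<in>transversals (insert P \<Q>). \<phi> (card (S \<inter> W)))
      = card (P \<inter> W) * (\<Sum>S\<in>transversals \<Q>. \<phi> (Suc (card (S \<inter> W))))
        + card (P - W) * (\<Sum>S\<in>transversals \<Q>. \<phi> (card (S \<inter> W)))" for \<phi> :: "nat \<Rightarrow> nat"
  proof -
    have "(\<Sum>x\<in>P. \<phi> (card (insert x S \<inter> W)))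
        = card (P \<inter> W) * \<phi> (Suc (card (S \<inter> W))) + card (P - W) * \<phi> (card (S \<inter> W))"
      if "S \<in> transversals \<Q>" for S
    proof -
      have "(\<Sum>x\<in>P. \<phi> (card (insert x S \<inter> W)))
          = (\<Sum>x\<in>P. if x \<in> W then \<phi> (Suc (card (S \<inter> W))) else \<phi> (card (S \<inter> W)))"
        by (rule sum.cong) (auto simp: cI[OF that])
      then show ?thesis using finP by (simp add: sum.If_cases Diff_eq)
    qed
    then show ?thesis
      by (simp add: sum_transversals_insert[OF finP disj] sum.distrib sum_distrib_left)
  qed
  have c2: "card (P \<inter> W) + card (P - W) = 2" using cP finP by (metis card_Int_Diff)
  consider "card (P \<inter> W) = 0" "card (P - W) = 2" | "card (P \<inter> W) = 1" "card (P - W) = 1"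
    | "card (P \<inter> W) = 2" "card (P - W) = 0" using c2 by linarith
  then show ?case
  proof cases
    case 1
    show ?thesis
    proof (rule insert.prems(1)[of "Suc n0" n1 n2])
      show "Suc n0 + n1 + n2 = card (insert P \<Q>)" using n insert.hyps by simp
      show "n1 + 2 * n2 = card (\<Union>(insert P \<Q>) \<inter> W)" unfolding cu using 1 n by simp
      show "(\<Sum>S\<in>transversals (insert P \<Q>). \<phi> (card (S \<inter> W)))
          = 2 ^ (Suc n0 + n2) * bsum n1 (\<lambda>k. \<phi> (k + n2))" for \<phi>
        unfolding step using 1 by (simp add: S)
    qed
  next
    case 2
    show ?thesis
    proof (rule insert.prems(1)[of n0 "Suc n1" n2])
      show "n0 + Suc n1 + n2 = card (insert P \<Q>)" using n insert.hyps by simp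
      show "Suc n1 + 2 * n2 = card (\<Union>(insert P \<Q>) \<inter> W)" unfolding cu using 2 n by simp
      show "(\<Sum>S\<in>transversals (insert P \<Q>). \<phi> (card (S \<inter> W)))
          = 2 ^ (n0 + n2) * bsum (Suc n1) (\<lambda>k. \<phi> (k + n2))" for \<phi>
        unfolding step using 2 by (simp add: S[of \<phi>] S[of "\<lambda>k. \<phi> (Suc k)"] bsum_Suc algebra_simps)
    qed
  next
    case 3
    show ?thesis
    proof (rule insert.prems(1)[of n0 n1 "Suc n2"])
      show "n0 + n1 + Suc n2 = card (insert P \<Q>)" using n insert.hyps by simp
      show "n1 + 2 * Suc n2 = card (\<Union>(insert P \<Q>) \<inter> W)" unfolding cu using 3 n by simp
      show "(\<Sum>S\<in>transversals (insert P \<Q>). \<phi> (card (S \<inter> W)))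
          = 2 ^ (n0 + Suc n2) * bsum n1 (\<lambda>k. \<phi> (k + Suc n2))" for \<phi>
        unfolding step using 3 by (simp add: S[of "\<lambda>k. \<phi> (Suc k)"])
    qed
  qed
qed

lemma card_transversals:
  assumes "finite \<Q>" "disjoint \<Q>" "\<And>P. P \<in> \<Q> \<Longrightarrow> card P = 2"
  shows "card (transversals \<Q>) = 2 ^ card \<Q>"
proof -
  obtain n0 n1 n2 where "n0 + n1 + n2 = card \<Q>" "n1 + 2 * n2 = card (\<Union>\<Q> \<inter> {})"
    and s: "\<And>\<phi> :: nat \<Rightarrow> nat. (\<Sum>S\<in>transversals \<Q>. \<phi> (card (S \<inter> {}))) = 2 ^ (n0 + n2) * bsum n1 (\<lambda>k. \<phi> (k + n2))"
    by (rule sum_transversals_inter_card[OF assms, where W = "{}"], assumption) (rule that)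
  \<comment> \<open>For \<open>W = {}\<close> the second equation forces \<open>n1 = n2 = 0\<close>,
    so the constant weight 1 evaluates to \<open>2 ^ n0\<close>.\<close>
  then show ?thesis using s[of "\<lambda>_. 1"] by simp
qed

section \<open>Counting nonstrong transversals\<close>

text \<open>The arcs are a bare relation, so that reversing them yields another instance and every
  fact about in-degrees dualizes to out-degrees. Regularity appears as explicit degrees: half of the
  \<open>2 * c - 2\<close> vertices outside the own partite set.\<close>

locale balanced_tournament =
  fixes V :: "'a set" and \<P> :: "'a set set" and E :: "('a \<times> 'a) set" and c :: nat
  assumes finite_V: "finite V" and partition: "partition_on V \<P>"
    and card_part: "P \<in> \<P> \<Longrightarrow> card P = 2" and card_parts: "card \<P> = c"
    and no_inner: "\<lbrakk>P \<in> \<P>; u \<in> P; v \<in> P\<rbrakk> \<Longrightarrow> (u, v) \<notin> E"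
    and orient: "\<lbrakk>P \<in> \<P>; Q \<in> \<P>; P \<noteq> Q; u \<in> P; v \<in> Q\<rbrakk> \<Longrightarrow> (u, v) \<in> E \<longleftrightarrow> (v, u) \<notin> E"
    and arcs_V: "E \<subseteq> V \<times> V"
    and in_card: "v \<in> V \<Longrightarrow> card {u. (u, v) \<in> E} = c - 1"
    and out_card: "v \<in> V \<Longrightarrow> card {u. (v, u) \<in> E} = c - 1"
begin

section \<open>Arc reversal and basic facts on transversals\<close>

lemma converse: "balanced_tournament V \<P> (E\<inverse>) c"
proof
  show "(u, v) \<in> E\<inverse> \<longleftrightarrow> (v, u) \<notin> E\<inverse>"
    if "P \<in> \<P>" "Q \<in> \<P>" "P \<noteq> Q" "u \<in> P" "v \<in> Q" for P Q u v
    using orient[OF that] by simp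
  show "E\<inverse> \<subseteq> V \<times> V" using arcs_V by auto
qed (simp_all add: finite_V partition card_part card_parts no_inner in_card out_card)

lemma finite_P: "finite \<P>"
  using finite_V partition finite_elements by blast

lemma disjoint_P: "disjoint \<P>"
  using partition by (simp add: partition_on_def)

lemma Union_P: "\<Union>\<P> = V"
  using partition by (simp add: partition_on_def)

definition nonstrong :: "'a set set" where
  "nonstrong = {S \<in> transversals \<P>. \<exists>A. A \<noteq> {} \<and> A \<subset> S \<and> A \<times> (S - A) \<subseteq> E}"

text \<open>Reversing the arcs exchanges the roles of \<open>A\<close> and \<open>S - A\<close>.
  This lets the digraph and its reverse share one set \<open>nonstrong\<close>.\<close>

lemma nonstrong_converse:
  "balanced_tournament.nonstrong \<P> (E\<inverse>) = nonstrong"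
proof -
  have "(\<exists>A. A \<noteq> {} \<and> A \<subset> S \<and> A \<times> (S - A) \<subseteq> E\<inverse>) \<longleftrightarrow> (\<exists>A. A \<noteq> {} \<and> A \<subset> S \<and> A \<times> (S - A) \<subseteq> E)" for S
  proof (intro iffI; elim exE conjE)
    fix A assume "A \<noteq> {}" "A \<subset> S" "A \<times> (S - A) \<subseteq> E\<inverse>"
    then show "\<exists>A. A \<noteq> {} \<and> A \<subset> S \<and> A \<times> (S - A) \<subseteq> E" by (intro exI[of _ "S - A"]) auto
  next
    fix A assume "A \<noteq> {}" "A \<subset> S" "A \<times> (S - A) \<subseteq> E"
    then show "\<exists>A. A \<noteq> {} \<and> A \<subset> S \<and> A \<times> (S - A) \<subseteq> E\<inverse>" by (intro exI[of _ "S - A"]) auto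
  qed
  then show ?thesis
    unfolding nonstrong_def balanced_tournament.nonstrong_def[OF converse] by simp
qed

lemma card_V: "card V = 2 * c"
proof -
  have "card (\<Union>\<P>) = (\<Sum>P\<in>\<P>. card P)"
    by (rule card_Union_disjoint) (use disjoint_P card_part card_ge_0_finite in \<open>force+\<close>)
  then show ?thesis by (simp add: Union_P card_part card_parts)
qed

lemma transversal_subset: "S \<in> transversals \<P> \<Longrightarrow> S \<subseteq> V"
  by (simp add: transversals_def Union_P)

lemma finite_transversal: "S \<in> transversals \<P> \<Longrightarrow> finite S"
  using transversal_subset finite_V finite_subset by blast

lemma transversal_complement:
  assumes "S \<in> transversals \<P>"
  shows "V - S \<in> transversals \<P>"
proof -
  have "card ((V - S) \<inter> P) = 1" if P: "P \<in> \<P>" for P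
  proof -
    have "(V - S) \<inter> P = P - S \<inter> P" using Union_P P by auto
    moreover have "card (P - S \<inter> P) = card P - card (S \<inter> P)"
      by (rule card_Diff_subset) (use finite_V Union_P P in \<open>auto intro: finite_subset[of _ V]\<close>)
    ultimately show ?thesis using P assms card_part by (simp add: transversals_def)
  qed
  then show ?thesis by (auto simp: transversals_def Union_P)
qed

lemma card_transversal:
  assumes "S \<in> transversals \<P>"
  shows "card S = c"
proof -
  have "S = (\<Union>P\<in>\<P>. S \<inter> P)" using assms by (auto simp: transversals_def)
  also have "card \<dots> = (\<Sum>P\<in>\<P>. card (S \<inter> P))"
    by (rule card_UN_disjoint)
      (use finite_P disjoint_P finite_transversal[OF assms] in \<open>auto simp: disjoint_def\<close>)
  also have "\<dots> = c" using assms by (simp add: transversals_def card_parts)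
  finally show ?thesis .
qed

lemma no_loop: "(v, v) \<notin> E"
  using no_inner arcs_V Union_P by blast

lemma no_digon: "(u, v) \<in> E \<Longrightarrow> (v, u) \<notin> E"
proof -
  assume uv: "(u, v) \<in> E"
  then obtain P Q where "P \<in> \<P>" "Q \<in> \<P>" "u \<in> P" "v \<in> Q" using arcs_V Union_P by blast
  then show ?thesis using uv no_inner orient[of P Q u v] by (cases "P = Q") auto
qed

lemma transversal_orient:
  assumes "S \<in> transversals \<P>" "u \<in> S" "v \<in> S" "u \<noteq> v"
  shows "(u, v) \<in> E \<longleftrightarrow> (v, u) \<notin> E"
proof -
  obtain P Q where PQ: "P \<in> \<P>" "Q \<in> \<P>" "u \<in> P" "v \<in> Q"
    using assms transversal_subset Union_P by blast
  have "P \<noteq> Q"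
  proof
    assume "P = Q"
    then have "card (S \<inter> P) = 1" "{u, v} \<subseteq> S \<inter> P" using assms PQ by (auto simp: transversals_def)
    then obtain x where "S \<inter> P = {x}" by (auto simp: card_1_singleton_iff)
    then show False using \<open>u \<noteq> v\<close> \<open>{u, v} \<subseteq> S \<inter> P\<close> by auto
  qed
  then show ?thesis using orient PQ by blast
qed

text \<open>\<open>A\<close> induces a tournament, so the sum counts its arcs, one for each pair of
  vertices. The arcs and their reverses partition the off-diagonal pairs of
  \<open>A \<times> A\<close>.\<close>

lemma sum_indegree:
  assumes S: "S \<in> transversals \<P>" and A: "A \<subseteq> S"
  shows "2 * (\<Sum>v\<in>A. card (A \<inter> {u. (u, v) \<in> E})) = card A * (card A - 1)"
proof -
  have fA: "finite A" using finite_transversal[OF S] A finite_subset by blast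
  have 1: "(\<Sum>v\<in>A. card (A \<inter> {u. (u, v) \<in> E})) = card (E \<inter> A \<times> A)"
  proof -
    have "(\<Sum>v\<in>A. card (A \<inter> {u. (u, v) \<in> E})) = card (SIGMA v:A. A \<inter> {u. (u, v) \<in> E})"
      using fA by (simp add: card_SigmaI)
    also have "(SIGMA v:A. A \<inter> {u. (u, v) \<in> E}) = (E \<inter> A \<times> A)\<inverse>" by auto
    finally have "(\<Sum>v\<in>A. card (A \<inter> {u. (u, v) \<in> E})) = card ((E \<inter> A \<times> A)\<inverse>)" .
    then show ?thesis by (simp only: card_inverse)
  qed
  have 2: "card (E \<inter> A \<times> A) = card (E\<inverse> \<inter> A \<times> A)"
    using card_inverse[of "E \<inter> A \<times> A"] by (simp add: converse_Int converse_Times)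
  have "A \<times> A - Id_on A = (E \<inter> A \<times> A) \<union> (E\<inverse> \<inter> A \<times> A)"
    using transversal_orient[OF S] A no_loop by (auto simp: Id_on_iff)
  moreover have "card \<dots> = card (E \<inter> A \<times> A) + card (E\<inverse> \<inter> A \<times> A)"
    by (rule card_Un_disjoint) (use fA no_digon in auto)
  moreover have "card (A \<times> A - Id_on A) = card A * card A - card A"
  proof -
    have "card (Id_on A) = card A"
      using card_image[of "\<lambda>x. (x, x)" A] by (simp add: Id_on_def inj_on_def UNION_singleton_eq_range)
    moreover have "Id_on A \<subseteq> A \<times> A" by auto
    ultimately show ?thesis using fA by (simp add: card_Diff_subset finite_subset card_cartesian_product)
  qed
  ultimately show ?thesis using 1 2 by (simp add: algebra_simps)
qed

section \<open>In-degrees inside a transversal and weighted double counting\<close>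

definition indeg :: "'a set \<Rightarrow> 'a \<Rightarrow> nat" where
  "indeg S v = card (S \<inter> {u. (u, v) \<in> E})"

lemma indeg_dominating:
  assumes "A \<subseteq> S" "A \<times> (S - A) \<subseteq> E" "v \<in> A"
  shows "indeg S v = card (A \<inter> {u. (u, v) \<in> E})"
proof -
  have "S \<inter> {u. (u, v) \<in> E} = A \<inter> {u. (u, v) \<in> E}"
    using assms no_digon by blast
  then show ?thesis by (simp add: indeg_def)
qed

text \<open>A linear minorant \<open>\<alpha> - \<beta> k\<close> of \<open>\<phi>\<close> suffices because the in-degrees inside \<open>A\<close> have a fixed sum.\<close>

lemma sum_weight_dominating:
  fixes \<alpha> \<beta> :: int
  assumes S: "S \<in> transversals \<P>" and A: "A \<subseteq> S" "A \<times> (S - A) \<subseteq> E"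
    and lin: "\<And>k. \<alpha> - \<beta> * int k \<le> int (\<phi> k)"
  shows "2 * \<alpha> * int (card A) - \<beta> * int (card A * (card A - 1)) \<le> 2 * int (\<Sum>v\<in>S. \<phi> (indeg S v))"
proof -
  have fS: "finite S" using finite_transversal[OF S] .
  have "2 * (\<Sum>v\<in>A. \<alpha> - \<beta> * int (indeg S v))
      = 2 * \<alpha> * int (card A) - \<beta> * int (2 * (\<Sum>v\<in>A. indeg S v))"
    by (simp add: sum_subtractf sum_distrib_left algebra_simps)
  moreover have "2 * (\<Sum>v\<in>A. indeg S v) = card A * (card A - 1)"
    using sum_indegree[OF S A(1)] indeg_dominating[OF A] by simp
  moreover have "(\<Sum>v\<in>A. \<alpha> - \<beta> * int (indeg S v)) \<le> (\<Sum>v\<in>A. int (\<phi> (indeg S v)))"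
    by (rule sum_mono) (rule lin)
  moreover have "(\<Sum>v\<in>A. \<phi> (indeg S v)) \<le> (\<Sum>v\<in>S. \<phi> (indeg S v))"
    by (rule sum_mono2) (use fS A in auto)
  then have "(\<Sum>v\<in>A. int (\<phi> (indeg S v))) \<le> int (\<Sum>v\<in>S. \<phi> (indeg S v))"
    by (metis of_nat_mono of_nat_sum)
  ultimately show ?thesis by simp
qed

text \<open>Here \<open>p\<close> is the number of partite sets consisting of two in-neighbours of
  \<open>v\<close>. Regularity gives as many consisting of two out-neighbours:
  \<open>n0 + n1 + n2\<close> and \<open>n1 + 2 * n2\<close> both equal \<open>c - 1\<close>, hence
  \<open>n0 = n2\<close>. The remaining \<open>n\<close> sets are fair tosses.\<close>

lemma sum_transversals_through:
  assumes v: "v \<in> V"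
  obtains n p where "n + 2 * p = c - 1"
    "\<And>\<phi> :: nat \<Rightarrow> nat. (\<Sum>S\<in>{S \<in> transversals \<P>. v \<in> S}. \<phi> (indeg S v)) = 4 ^ p * bsum n (\<lambda>k. \<phi> (k + p))"
proof -
  obtain P where P: "P \<in> \<P>" "v \<in> P" using v Union_P by blast
  define \<Q> where "\<Q> = \<P> - {P}"
  have PQ: "\<P> = insert P \<Q>" using P by (auto simp: \<Q>_def)
  have fQ: "finite \<Q>" and dQ: "disjoint \<Q>" and cQ: "card \<Q> = c - 1"
    using finite_P disjoint_P P card_parts by (auto simp: \<Q>_def pairwise_def)
  have cardQ: "card Q = 2" if "Q \<in> \<Q>" for Q using that card_part by (simp add: \<Q>_def)
  have PU: "P \<inter> \<Union>\<Q> = {}" using disjoint_P P by (auto simp: \<Q>_def disjoint_def)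
  let ?W = "{u. (u, v) \<in> E}"
  have WP: "?W \<inter> P = {}" using no_inner P by blast
  have W: "\<Union>\<Q> \<inter> ?W = ?W" using WP arcs_V Union_P PQ by auto
  obtain n0 n1 n2 where n: "n0 + n1 + n2 = card \<Q>" "n1 + 2 * n2 = card (\<Union>\<Q> \<inter> ?W)"
    and s: "\<And>\<phi> :: nat \<Rightarrow> nat. (\<Sum>S\<in>transversals \<Q>. \<phi> (card (S \<inter> ?W))) = 2 ^ (n0 + n2) * bsum n1 (\<lambda>k. \<phi> (k + n2))"
    by (rule sum_transversals_inter_card[OF fQ dQ cardQ, where W = ?W], assumption) (rule that)
  have n12: "n1 + 2 * n2 = c - 1" using n(2) W in_card[OF v] by simp
  then have "n0 = n2" using n(1) cQ by simp
  then have pow: "2 ^ (n0 + n2) = (4 :: nat) ^ n2" by (simp add: mult_2[symmetric] power_mult)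
  have fP: "finite P" using card_part[OF P(1)] by (simp add: card_ge_0_finite)
  have "(\<Sum>S\<in>{S \<in> transversals \<P>. v \<in> S}. \<phi> (indeg S v)) = (\<Sum>S\<in>transversals \<Q>. \<phi> (card (S \<inter> ?W)))"
    for \<phi> :: "nat \<Rightarrow> nat"
  proof -
    have "(\<Sum>S\<in>{S \<in> transversals \<P>. v \<in> S}. \<phi> (indeg S v))
        = (\<Sum>S\<in>transversals (insert P \<Q>). if v \<in> S then \<phi> (indeg S v) else 0)"
      unfolding PQ[symmetric]
      by (rule sum.inter_filter) (use finite_transversals finite_V Union_P in auto)
    also have "\<dots> = (\<Sum>S\<in>transversals \<Q>. \<Sum>x\<in>P. if v \<in> insert x S then \<phi> (indeg (insert x S) v) else 0)"
      by (rule sum_transversals_insert[OF fP PU])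
    also have "\<dots> = (\<Sum>S\<in>transversals \<Q>. \<phi> (card (S \<inter> ?W)))"
    proof (rule sum.cong[OF refl])
      fix S assume "S \<in> transversals \<Q>"
      \<comment> \<open>Since \<open>S\<close> avoids \<open>P\<close>, only the choice
        \<open>x = v\<close> gives a transversal through \<open>v\<close>; the partner of
        \<open>v\<close> contributes 0.\<close>
      then have "v \<notin> S" using PU P by (auto simp: transversals_def)
      moreover have "indeg (insert v S) v = card (S \<inter> ?W)" using no_loop by (simp add: indeg_def)
      ultimately have "(\<Sum>x\<in>P. if v \<in> insert x S then \<phi> (indeg (insert x S) v) else 0)
          = (\<Sum>x\<in>P. if x = v then \<phi> (card (S \<inter> ?W)) else 0)"
        by (intro sum.cong) auto
      then show "(\<Sum>x\<in>P. if v \<in> insert x S then \<phi> (indeg (insert x S) v) else 0) = \<phi> (card (S \<inter> ?W))"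
        using fP P by simp
    qed
    finally show ?thesis .
  qed
  then have "(\<Sum>S\<in>{S \<in> transversals \<P>. v \<in> S}. \<phi> (indeg S v)) = 4 ^ n2 * bsum n1 (\<lambda>k. \<phi> (k + n2))"
    for \<phi> :: "nat \<Rightarrow> nat"
    using s[of \<phi>] pow by simp
  then show thesis using that n12 by blast
qed

lemma sum_convex_through:
  assumes "v \<in> V" "\<And>k. 2 * \<phi> (Suc k) \<le> \<phi> k + \<phi> (Suc (Suc k))"
  shows "(\<Sum>S\<in>{S \<in> transversals \<P>. v \<in> S}. \<phi> (indeg S v)) \<le> bsum (c - 1) \<phi>"
proof -
  obtain n p where np: "n + 2 * p = c - 1" and
    s: "\<And>\<phi> :: nat \<Rightarrow> nat. (\<Sum>S\<in>{S \<in> transversals \<P>. v \<in> S}. \<phi> (indeg S v)) = 4 ^ p * bsum n (\<lambda>k. \<phi> (k + p))"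
    by (rule sum_transversals_through[OF assms(1)]) (rule that)
  show ?thesis unfolding s np[symmetric] by (rule bsum_convex) (rule assms(2))
qed

text \<open>Double counting of the pairs \<open>(v, S)\<close> with \<open>v \<in> S\<close>. If
  each complementary pair had a nonstrong member, at least \<open>2 ^ (c - 1)\<close> transversals
  would be nonstrong, each of total weight at least \<open>M\<close>, whereas the
  \<open>2 * c\<close> vertices collect at most \<open>K\<close> each.\<close>

lemma strong_transversals_exist:
  assumes M: "\<And>S. S \<in> nonstrong \<Longrightarrow> M \<le> (\<Sum>v\<in>S. w v S)"
    and K: "\<And>v. v \<in> V \<Longrightarrow> (\<Sum>S\<in>{S \<in> transversals \<P>. v \<in> S}. w v S) \<le> K"
    and less: "2 * c * K < M * 2 ^ (c - 1)" and c: "c \<ge> 1"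
  shows "\<exists>S\<in>transversals \<P>. S \<notin> nonstrong \<and> V - S \<notin> nonstrong"
proof (rule ccontr)
  let ?T = "transversals \<P>"
  assume "\<not> ?thesis"
  then have neg: "S \<in> nonstrong \<or> V - S \<in> nonstrong" if "S \<in> ?T" for S using that by blast
  have fT: "finite ?T" using finite_transversals finite_V Union_P by auto
  have sub: "nonstrong \<subseteq> ?T" by (auto simp: nonstrong_def)
  then have fN: "finite nonstrong" using fT finite_subset by blast
  have "?T \<subseteq> nonstrong \<union> (\<lambda>S. V - S) ` nonstrong"
  proof
    fix S assume S: "S \<in> ?T"
    then have "S = V - (V - S)" using transversal_subset by auto
    then show "S \<in> nonstrong \<union> (\<lambda>S. V - S) ` nonstrong" using neg[OF S] by blast
  qed
  then have "card ?T \<le> card (nonstrong \<union> (\<lambda>S. V - S) ` nonstrong)"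
    using fN by (intro card_mono) auto
  also have "\<dots> \<le> card nonstrong + card ((\<lambda>S. V - S) ` nonstrong)" by (rule card_Un_le)
  also have "\<dots> \<le> 2 * card nonstrong" using card_image_le[OF fN, of "\<lambda>S. V - S"] by simp
  also have "card ?T = 2 * 2 ^ (c - 1)"
    using card_transversals[OF finite_P disjoint_P card_part] card_parts c
    by (simp flip: power_Suc)
  finally have "2 ^ (c - 1) \<le> card nonstrong" by simp
  then have "M * 2 ^ (c - 1) \<le> (\<Sum>S\<in>nonstrong. M)" by simp
  also have "\<dots> \<le> (\<Sum>S\<in>nonstrong. \<Sum>v\<in>S. w v S)" by (rule sum_mono) (rule M)
  also have "\<dots> \<le> (\<Sum>S\<in>?T. \<Sum>v\<in>S. w v S)" by (rule sum_mono2[OF fT sub]) simp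
  also have "\<dots> = (\<Sum>S\<in>?T. \<Sum>v\<in>{v \<in> V. v \<in> S}. w v S)"
    by (intro sum.cong refl) (use transversal_subset in auto)
  also have "\<dots> = (\<Sum>v\<in>V. \<Sum>S\<in>{S \<in> ?T. v \<in> S}. w v S)"
    by (rule sum.swap_restrict[OF fT finite_V])
  also have "\<dots> \<le> (\<Sum>v\<in>V. K)" by (rule sum_mono) (rule K)
  also have "\<dots> = 2 * c * K" by (simp add: card_V)
  finally show False using less by simp
qed

end

section \<open>Eight or more partite sets\<close>

text \<open>Below, \<open>j - k\<close> is truncated: the weight \<open>\<lambda>k. j - k\<close> vanishes for \<open>k \<ge> j\<close>, which keeps it convex.\<close>

lemma bsum_truncated_le: "3 ^ (n + 1) * bsum n (\<lambda>k. j - k) \<le> 3 ^ j * 4 ^ n"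
proof (induction n arbitrary: j)
  case 0
  show ?case
  proof (induction j)
    case (Suc j)
    \<comment> \<open>This is the pointwise estimate of \<open>j - k\<close> by
      \<open>3 ^ (j - k - 1)\<close>. Summed against the binomial coefficients, it gives
      \<open>3 ^ (j - 1) * (4 / 3) ^ n\<close>, a Chernoff bound; the induction on \<open>n\<close>
      avoids negative exponents.\<close>
    have "Suc j \<le> 3 ^ j" by (induction j) auto
    then show ?case by simp
  qed simp
next
  case (Suc n)
  show ?case
  proof (cases j)
    case 0
    then show ?thesis by (simp add: bsum_def)
  next
    case (Suc i)
    have "3 ^ (Suc n + 1) * bsum (Suc n) (\<lambda>k. j - k)
        = 3 * (3 ^ (n + 1) * bsum n (\<lambda>k. j - k)) + 3 * (3 ^ (n + 1) * bsum n (\<lambda>k. i - k))"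
      by (simp add: bsum_Suc Suc algebra_simps)
    also have "\<dots> \<le> 3 * (3 ^ j * 4 ^ n) + 3 * (3 ^ i * 4 ^ n)"
      by (intro add_mono mult_left_mono Suc.IH) auto
    also have "\<dots> = 3 ^ j * 4 ^ Suc n" by (simp add: Suc)
    finally show ?thesis .
  qed
qed

text \<open>Raising \<open>j\<close> by 1 multiplies the two sides by 16 and 27. The inequality
  still fails for \<open>j = 5\<close>; starting at 6 corresponds to \<open>c \<ge> 22\<close> in
  the next lemma.\<close>

lemma pow2_less_pow3: "6 \<le> j \<Longrightarrow> 2 ^ (4 * j + 1) < (3 :: nat) ^ (3 * j - 2)"
proof (induction j rule: dec_induct)
  case (step j)
  have "2 ^ (4 * Suc j + 1) = 16 * (2 :: nat) ^ (4 * j + 1)" by (simp add: power_add)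
  also have "\<dots> < 27 * (3 :: nat) ^ (3 * j - 2)" using step.IH by linarith
  also have "\<dots> = 3 ^ (3 * Suc j - 2)"
  proof -
    have "3 * Suc j - 2 = 3 + (3 * j - 2)" using step.hyps by simp
    then show ?thesis by (simp only: power_add) simp
  qed
  finally show ?case .
qed simp

text \<open>After multiplication by \<open>3 ^ c\<close>, \<open>bsum_truncated_le\<close> reduces
  the claim to the inequality \<open>main\<close> between powers of 2 and 3. As \<open>j\<close> is
  about \<open>c / 4\<close>, it compares 16 with 27 per unit of \<open>j\<close>.\<close>

lemma bsum_truncated_bound_large:
  assumes c: "c \<ge> 22" and j: "j = (c div 2 + 1) div 2"
  shows "4 * c * bsum (c - 1) (\<lambda>k. j - k) < j * 2 ^ (c - 1)"
proof -
  have j6: "6 \<le> j" using c j by linarith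
  \<comment> \<open>\<open>c div 2\<close> is \<open>2 * j - 1\<close> or \<open>2 * j\<close>,
    which leaves four values of \<open>c\<close> for each \<open>j\<close>.\<close>
  obtain r where r: "c = 4 * j - 2 + r" "r \<le> 3"
    by (rule that[of "c - (4 * j - 2)"]) (use j c in linarith)+
  have main: "4 * c * 3 ^ j * 2 ^ (c - 1) < j * (3 :: nat) ^ c"
  proof -
    have e1: "c - 1 = (4 * j - 3) + r" using r j6 by linarith
    have base: "16 * 3 ^ j * 2 ^ (4 * j - 3) < (3 :: nat) ^ (4 * j - 2)"
    proof -
      have "16 * 3 ^ j * 2 ^ (4 * j - 3) = 3 ^ j * (2 :: nat) ^ (4 + (4 * j - 3))"
        by (simp only: power_add) simp
      also have "4 + (4 * j - 3) = 4 * j + 1" using j6 by simp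
      also have "3 ^ j * (2 :: nat) ^ (4 * j + 1) < 3 ^ j * 3 ^ (3 * j - 2)"
        using pow2_less_pow3[OF j6] by simp
      also have "\<dots> = 3 ^ (4 * j - 2)"
      proof -
        have "4 * j - 2 = j + (3 * j - 2)" using j6 by simp
        then show ?thesis by (simp only: power_add)
      qed
      finally show ?thesis .
    qed
    \<comment> \<open>The linear factor \<open>c\<close> is traded for \<open>4 * j\<close>; the
      excess caused by \<open>r\<close> is absorbed in passing from \<open>2 ^ r\<close> to
      \<open>3 ^ r\<close>.\<close>
    have "4 * c * 2 ^ r \<le> 16 * j * 3 ^ r"
    proof -
      consider "r = 0" | "r = 1" | "r = 2" | "r = 3" using r(2) by linarith
      then show ?thesis by cases (use r(1) j6 in auto)
    qed
    then have "4 * c * 3 ^ j * 2 ^ (c - 1) \<le> (16 * j * 3 ^ r) * (3 ^ j * 2 ^ (4 * j - 3))"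
      using mult_le_mono1[of "4 * c * 2 ^ r" "16 * j * 3 ^ r" "3 ^ j * 2 ^ (4 * j - 3)"]
      unfolding e1 by (simp add: power_add mult.assoc mult.left_commute)
    also have "\<dots> = j * 3 ^ r * (16 * 3 ^ j * 2 ^ (4 * j - 3))" by simp
    also have "\<dots> < j * 3 ^ r * 3 ^ (4 * j - 2)" using base j6 by simp
    also have "\<dots> = j * 3 ^ c" unfolding r(1) by (simp add: power_add)
    finally show ?thesis .
  qed
  let ?b = "bsum (c - 1) (\<lambda>k. j - k)"
  have "3 ^ c * ?b \<le> 3 ^ j * 4 ^ (c - 1)"
    using bsum_truncated_le[of "c - 1" j] c by simp
  then have "4 * c * (3 ^ c * ?b) \<le> 4 * c * (3 ^ j * 4 ^ (c - 1))"
    by (rule mult_le_mono2)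
  also have "(4 :: nat) ^ (c - 1) = 2 ^ (c - 1) * 2 ^ (c - 1)"
    by (simp flip: power_mult_distrib)
  also have "4 * c * (3 ^ j * (2 ^ (c - 1) * 2 ^ (c - 1))) = (4 * c * 3 ^ j * 2 ^ (c - 1)) * 2 ^ (c - 1)"
    by (simp only: mult.assoc)
  also have "\<dots> < (j * 3 ^ c) * 2 ^ (c - 1)"
    by (rule mult_strict_right_mono[OF main]) simp
  finally have "3 ^ c * (4 * c * ?b) < 3 ^ c * (j * 2 ^ (c - 1))"
    by (simp only: mult_ac)
  then show ?thesis by simp
qed

lemma bsum_truncated_eq:
  assumes "j \<le> n"
  shows "bsum n (\<lambda>k. j - k) = (\<Sum>k<j. (n choose k) * (j - k))"
  unfolding bsum_def by (rule sum.mono_neutral_right) (use assms in auto)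

text \<open>The values below 22 are evaluated one by one. The inequality is false for
  \<open>c = 8\<close> (288 against 256) and for \<open>c = 10\<close> (2280 against 1536), so these
  two get other weights later.\<close>

lemma bsum_truncated_bound:
  assumes c: "c \<ge> 9" "c \<noteq> 10" and j: "j = (c div 2 + 1) div 2"
  shows "4 * c * bsum (c - 1) (\<lambda>k. j - k) < j * 2 ^ (c - 1)"
proof (cases "c \<ge> 22")
  case False
  then have "c = 9 \<or> c = 11 \<or> c = 12 \<or> c = 13 \<or> c = 14 \<or> c = 15 \<or> c = 16 \<or> c = 17 \<or>
      c = 18 \<or> c = 19 \<or> c = 20 \<or> c = 21" using c by presburger
  then show ?thesis
    unfolding j by (elim disjE) (simp_all add: bsum_truncated_eq lessThan_nat_numeral binomial_fact' fact_numeral)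
qed (use bsum_truncated_bound_large j in simp)

context balanced_tournament
begin

text \<open>In the reversed digraph \<open>rev.indeg\<close> is the out-degree, while the nonstrong
  transversals stay the same.\<close>

interpretation rev: balanced_tournament V \<P> "E\<inverse>" c
  rewrites "balanced_tournament.nonstrong \<P> (E\<inverse>) = nonstrong"
  by (rule converse) (rule nonstrong_converse)

text \<open>\<open>L a\<close> bounds from below the weight collected by a dominating side of
  \<open>a\<close> vertices, certified by a linear minorant with coefficients
  \<open>\<alpha>\<close> and \<open>\<beta>\<close>; \<open>M\<close> combines the bounds of the
  two sides. In-degrees and out-degrees cost at most \<open>bsum (c - 1) \<phi>\<close> each at
  every vertex, whence the factor 4.\<close>

lemma strong_transversals_exist_convex:
  assumes convex: "\<And>k. 2 * \<phi> (Suc k) \<le> \<phi> k + \<phi> (Suc (Suc k))"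
    and L: "\<And>a. 1 \<le> a \<Longrightarrow> a < c \<Longrightarrow> \<exists>\<alpha> \<beta> :: int. (\<forall>k. \<alpha> - \<beta> * int k \<le> int (\<phi> k)) \<and>
        2 * int (L a) \<le> 2 * \<alpha> * int a - \<beta> * int (a * (a - 1))"
    and M: "\<And>a. 1 \<le> a \<Longrightarrow> a < c \<Longrightarrow> M \<le> L a + L (c - a)"
    and less: "4 * c * bsum (c - 1) \<phi> < M * 2 ^ (c - 1)" and c: "c \<ge> 1"
  shows "\<exists>S\<in>transversals \<P>. S \<notin> nonstrong \<and> V - S \<notin> nonstrong"
proof (rule strong_transversals_exist[where M = M and K = "2 * bsum (c - 1) \<phi>"
      and w = "\<lambda>v S. \<phi> (indeg S v) + \<phi> (rev.indeg S v)"])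
  fix S assume "S \<in> nonstrong"
  then obtain A where S: "S \<in> transversals \<P>" and A: "A \<noteq> {}" "A \<subset> S" "A \<times> (S - A) \<subseteq> E"
    by (auto simp: nonstrong_def)
  let ?B = "S - A"
  have fS: "finite S" using finite_transversal[OF S] .
  then have fA: "finite A" using A finite_subset by blast
  have a: "1 \<le> card A" using A fA by (simp add: Suc_le_eq card_gt_0_iff)
  have ac: "card A < c" using psubset_card_mono[OF fS A(2)] card_transversal[OF S] by simp
  have b: "card ?B = c - card A"
    using card_Diff_subset[OF fA] A(2) card_transversal[OF S] by auto
  obtain \<alpha> \<beta> :: int where lin: "\<And>k. \<alpha> - \<beta> * int k \<le> int (\<phi> k)"
    and "2 * int (L (card A)) \<le> 2 * \<alpha> * int (card A) - \<beta> * int (card A * (card A - 1))"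
    using L[OF a ac] by blast
  moreover have "2 * \<alpha> * int (card A) - \<beta> * int (card A * (card A - 1)) \<le> 2 * int (\<Sum>v\<in>S. \<phi> (indeg S v))"
    by (rule sum_weight_dominating[OF S _ A(3) lin]) (use A in auto)
  ultimately have 1: "L (card A) \<le> (\<Sum>v\<in>S. \<phi> (indeg S v))" by linarith
  \<comment> \<open>In the reversed digraph all arcs go from \<open>S - A\<close> to
    \<open>A\<close>, so the same bound applies to out-degrees.\<close>
  have "1 \<le> card ?B" "card ?B < c" using b a ac by simp_all
  then obtain \<alpha> \<beta> :: int where lin: "\<And>k. \<alpha> - \<beta> * int k \<le> int (\<phi> k)"
    and "2 * int (L (card ?B)) \<le> 2 * \<alpha> * int (card ?B) - \<beta> * int (card ?B * (card ?B - 1))"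
    using L by blast
  moreover have "2 * \<alpha> * int (card ?B) - \<beta> * int (card ?B * (card ?B - 1)) \<le> 2 * int (\<Sum>v\<in>S. \<phi> (rev.indeg S v))"
    by (rule rev.sum_weight_dominating[OF S _ _ lin]) (use A in auto)
  ultimately have 2: "L (card ?B) \<le> (\<Sum>v\<in>S. \<phi> (rev.indeg S v))" by linarith
  show "M \<le> (\<Sum>v\<in>S. \<phi> (indeg S v) + \<phi> (rev.indeg S v))"
    using M[OF a ac] 1 2 by (simp add: sum.distrib b)
next
  fix v assume "v \<in> V"
  then show "(\<Sum>S\<in>{S \<in> transversals \<P>. v \<in> S}. \<phi> (indeg S v) + \<phi> (rev.indeg S v)) \<le> 2 * bsum (c - 1) \<phi>"
    using sum_convex_through[of v \<phi>] rev.sum_convex_through[of v \<phi>] convex by (simp add: sum.distrib)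
qed (use less c in simp_all)

lemma strong_transversals_large:
  assumes c: "c \<ge> 8"
  shows "\<exists>S\<in>transversals \<P>. S \<notin> nonstrong \<and> V - S \<notin> nonstrong"
proof -
  consider "c = 8" | "c = 10" | "c \<ge> 9" "c \<noteq> 10" using c by linarith
  then show ?thesis
  proof cases
    case 1
    \<comment> \<open>The final comparison is 320 < 384. The minorants are the chords of
      \<open>?\<phi>\<close> through 0 and 1 and through 1 and 2, chosen by the mean in-degree
      \<open>(a - 1) / 2\<close> inside a side of size \<open>a\<close>. For \<open>a = 4\<close>
      only 2 is guaranteed, but then both sides contribute.\<close>
    let ?\<phi> = "\<lambda>k :: nat. if k = 0 then 3 else if k = 1 then 1 else 0 :: nat"
    show ?thesis
    proof (rule strong_transversals_exist_convex[where \<phi> = ?\<phi> and M = 3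
          and L = "\<lambda>a. if a \<le> 3 then 3 else if a = 4 then 2 else 0"])
      fix a assume "1 \<le> a" "a < c"
      then consider "a = 1 \<or> a = 2 \<or> a = 3" | "a = 4" | "a > 4" by linarith
      then show "\<exists>\<alpha> \<beta> :: int. (\<forall>k. \<alpha> - \<beta> * int k \<le> int (?\<phi> k)) \<and>
          2 * int (if a \<le> 3 then 3 else if a = 4 then 2 else 0) \<le> 2 * \<alpha> * int a - \<beta> * int (a * (a - 1))"
      proof cases
        case 1 then show ?thesis by (intro exI[of _ 3] exI[of _ 2]) auto
      next
        case 2 then show ?thesis by (intro exI[of _ 2] exI[of _ 1]) auto
      next
        case 3 then show ?thesis by (intro exI[of _ 0]) auto
      qed
    qed (use 1 in \<open>auto simp: bsum_def atMost_nat_numeral binomial_fact' fact_numeral\<close>)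
  next
    case 2
    \<comment> \<open>The final comparison is 5080 < 5120. The chord through 1 and 2 serves all
      sizes from 2 to 5; a single vertex needs the full value at 0.\<close>
    let ?\<phi> = "\<lambda>k :: nat. if k = 0 then 10 else if k = 1 then 5 else if k = 2 then 2 else 0 :: nat"
    show ?thesis
    proof (rule strong_transversals_exist_convex[where \<phi> = ?\<phi> and M = 10
          and L = "\<lambda>a. if a \<le> 5 then 10 else 0"])
      fix a assume "1 \<le> a" "a < c"
      then consider "a = 1" | "a = 2 \<or> a = 3 \<or> a = 4 \<or> a = 5" | "a > 5" by linarith
      then show "\<exists>\<alpha> \<beta> :: int. (\<forall>k. \<alpha> - \<beta> * int k \<le> int (?\<phi> k)) \<and>
          2 * int (if a \<le> 5 then 10 else 0) \<le> 2 * \<alpha> * int a - \<beta> * int (a * (a - 1))"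
      proof cases
        case 1 then show ?thesis by (intro exI[of _ 10] exI[of _ 10]) auto
      next
        case 2 then show ?thesis by (intro exI[of _ 8] exI[of _ 3]) auto
      next
        case 3 then show ?thesis by (intro exI[of _ 0]) auto
      qed
    qed (use 2 in \<open>auto simp: bsum_def atMost_nat_numeral binomial_fact' fact_numeral\<close>)
  next
    case 3
    \<comment> \<open>The least \<open>j\<close> with \<open>c div 2 \<le> 2 * j\<close>; the
      smaller side then always collects \<open>j\<close>.\<close>
    define j where "j = (c div 2 + 1) div 2"
    have j: "c div 2 \<le> 2 * j" unfolding j_def by linarith
    show ?thesis
    proof (rule strong_transversals_exist_convex[where \<phi> = "\<lambda>k. j - k" and M = j
          and L = "\<lambda>a. if a \<le> c div 2 then j else 0"])
      fix a assume a: "1 \<le> a" "a < c"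
      show "\<exists>\<alpha> \<beta> :: int. (\<forall>k. \<alpha> - \<beta> * int k \<le> int (j - k)) \<and>
          2 * int (if a \<le> c div 2 then j else 0) \<le> 2 * \<alpha> * int a - \<beta> * int (a * (a - 1))"
      proof (cases "a \<le> c div 2")
        case True
        \<comment> \<open>The side collects at least \<open>a * j - a * (a - 1) / 2\<close>, and
          this is at least \<open>j\<close> exactly when the displayed product is
          nonnegative.\<close>
        then have "0 \<le> (int a - 1) * (2 * int j - int a)" using a j by simp
        moreover have "int (a * (a - 1)) = int a * (int a - 1)" using a by (simp add: of_nat_diff)
        ultimately have "2 * int j \<le> 2 * int j * int a - 1 * int (a * (a - 1))"
          by (simp add: algebra_simps)
        then show ?thesis using True by (intro exI[of _ "int j"] exI[of _ 1]) auto
      next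
        case False
        then show ?thesis by (intro exI[of _ 0]) auto
      qed
    next
      show "4 * c * bsum (c - 1) (\<lambda>k. j - k) < j * 2 ^ (c - 1)"
        by (rule bsum_truncated_bound[OF 3 j_def])
    qed (use 3 in auto)
  qed
qed

end

section \<open>Six or seven partite sets\<close>

context balanced_tournament
begin

section \<open>Small dominating sides: sources and cyclic triangles\<close>

definition triangle_led :: "'a \<Rightarrow> 'a set set" where
  "triangle_led v = {S \<in> transversals \<P>. v \<in> S \<and> (\<exists>u\<in>S. \<exists>w\<in>S. (v, u) \<in> E \<and> (u, w) \<in> E \<and> (w, v) \<in> E \<and>
     {v, u, w} \<times> (S - {v, u, w}) \<subseteq> E)}"

text \<open>Without a source all in-degrees in \<open>A\<close> are at least 1, while they sum to
  \<open>card A * (card A - 1) / 2\<close>. This forces three vertices, each of in-degree exactly 1,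
  which is a cyclic triangle.\<close>

lemma source_or_triangle_led:
  assumes S: "S \<in> transversals \<P>" and A: "A \<noteq> {}" "A \<subseteq> S" "A \<times> (S - A) \<subseteq> E" and c3: "card A \<le> 3"
  shows "(\<exists>v\<in>A. indeg S v = 0) \<or> card A = 3 \<and> (\<forall>v\<in>A. S \<in> triangle_led v)"
proof (rule disjCI)
  assume "\<not> (card A = 3 \<and> (\<forall>v\<in>A. S \<in> triangle_led v))"
  show "\<exists>v\<in>A. indeg S v = 0"
  proof (rule ccontr)
    assume neg: "\<not> (\<exists>v\<in>A. indeg S v = 0)"
    let ?d = "\<lambda>v. card (A \<inter> {u. (u, v) \<in> E})"
    have fA: "finite A" using finite_transversal[OF S] A(2) finite_subset by blast
    have d1: "1 \<le> ?d v" if "v \<in> A" for v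
      using neg that indeg_dominating[OF A(2,3) that] by force
    have s: "2 * (\<Sum>v\<in>A. ?d v) = card A * (card A - 1)" by (rule sum_indegree[OF S A(2)])
    have "card A \<le> (\<Sum>v\<in>A. ?d v)" using sum_mono[of A "\<lambda>_. 1" ?d] d1 by simp
    then have "2 * card A \<le> card A * (card A - 1)" using s by linarith
    moreover have "0 < card A" using A(1) fA by (simp add: card_gt_0_iff)
    ultimately have "2 \<le> card A - 1" by simp
    then have a3: "card A = 3" using c3 by linarith
    have one: "?d v = 1" if v: "v \<in> A" for v
    proof (rule ccontr)
      assume "?d v \<noteq> 1"
      then have "(\<Sum>v\<in>A. 1) < (\<Sum>v\<in>A. ?d v)"
        using d1 v fA by (intro sum_strict_mono_ex1) force+
      then show False using s a3 by simp
    qed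
    have "S \<in> triangle_led v" if v: "v \<in> A" for v
    proof -
      obtain w where w: "A \<inter> {u. (u, v) \<in> E} = {w}" using one[OF v] by (auto simp: card_1_singleton_iff)
      then have wA: "w \<in> A" "(w, v) \<in> E" "w \<noteq> v" using no_loop by auto
      have "card (A - {v, w}) = 1" using a3 v wA by (simp add: card_Diff_subset)
      then obtain u where u: "A - {v, w} = {u}" by (auto simp: card_1_singleton_iff)
      then have uA: "u \<in> A" "u \<noteq> v" "u \<noteq> w" and Aeq: "A = {v, u, w}" using v wA by auto
      have uv: "(u, v) \<notin> E" using w uA by auto
      then have vu: "(v, u) \<in> E" using transversal_orient[OF S, of u v] uA v A(2) by auto
      have "(w, u) \<notin> E"
      proof
        assume "(w, u) \<in> E"
        then have "{v, w} \<subseteq> A \<inter> {x. (x, u) \<in> E}" using vu v wA by auto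
        then have "card {v, w} \<le> ?d u" using fA by (intro card_mono) auto
        then show False using one[OF uA(1)] wA by simp
      qed
      then have "(u, w) \<in> E" using transversal_orient[OF S, of u w] uA wA A(2) by auto
      then show ?thesis unfolding triangle_led_def using S v uA wA vu A Aeq by blast
    qed
    then show False using \<open>\<not> (card A = 3 \<and> (\<forall>v\<in>A. S \<in> triangle_led v))\<close> a3 by blast
  qed
qed

lemma triangle_led_indeg:
  assumes "S \<in> triangle_led v"
  shows "indeg S v = 1"
proof -
  obtain u w where S: "w \<in> S" "(v, u) \<in> E" "(w, v) \<in> E" "{v, u, w} \<times> (S - {v, u, w}) \<subseteq> E"
    using assms by (auto simp: triangle_led_def)
  have "S \<inter> {x. (x, v) \<in> E} = {w}"
  proof (intro subset_antisym subsetI)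
    fix x assume x: "x \<in> S \<inter> {x. (x, v) \<in> E}"
    then have "x \<noteq> v" "x \<noteq> u" "(v, x) \<notin> E" using no_loop no_digon S by auto
    then show "x \<in> {w}" using S x by blast
  qed (use S in auto)
  then show ?thesis by (simp add: indeg_def)
qed

lemma finite_transversals_P: "finite (transversals \<P>)"
  by (rule finite_transversals) (simp add: Union_P finite_V)

text \<open>With \<open>p\<close> partite sets of two in-neighbours, \<open>v\<close> has in-degree
  at least \<open>p\<close> in every transversal. For \<open>p = 0\<close> exactly one transversal
  has \<open>v\<close> as a source; for \<open>p = 1\<close> none does, and in-degree 1 occurs
  \<open>4 ^ 1\<close> times; for \<open>p \<ge> 2\<close> neither value occurs.\<close>

lemma card_sources_le:
  assumes v: "v \<in> V"
  shows "card {S \<in> transversals \<P>. v \<in> S \<and> indeg S v = 0} \<le> 1 \<and>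
    (card {S \<in> transversals \<P>. v \<in> S \<and> indeg S v = 0} = 0 \<longrightarrow> card (triangle_led v) \<le> 4)"
proof -
  obtain n p where np: "n + 2 * p = c - 1" and
    s: "\<And>\<phi> :: nat \<Rightarrow> nat. (\<Sum>S\<in>{S \<in> transversals \<P>. v \<in> S}. \<phi> (indeg S v)) = 4 ^ p * bsum n (\<lambda>k. \<phi> (k + p))"
    by (rule sum_transversals_through[OF v]) (rule that)
  have cnt: "card {S \<in> transversals \<P>. v \<in> S \<and> indeg S v = m} = 4 ^ p * bsum n (\<lambda>k. if k + p = m then 1 else 0)" for m
  proof -
    have "{S \<in> transversals \<P>. v \<in> S \<and> indeg S v = m} = {S \<in> {S \<in> transversals \<P>. v \<in> S}. indeg S v = m}"
      by auto
    then have "card {S \<in> transversals \<P>. v \<in> S \<and> indeg S v = m} = (\<Sum>S\<in>{S \<in> transversals \<P>. v \<in> S}. if indeg S v = m then 1 else 0)"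
      using sum.inter_filter[of "{S \<in> transversals \<P>. v \<in> S}" "\<lambda>_. 1::nat" "\<lambda>S. indeg S v = m"] finite_transversals_P
      by simp
    then show ?thesis unfolding s[of "\<lambda>k. if k = m then 1 else 0"] .
  qed
  have z: "bsum n (\<lambda>k. if k = 0 then 1 else 0) = 1"
    by (simp add: bsum_def if_distrib[of "\<lambda>x. _ * x"] cong: if_cong)
  have zero: "bsum n (\<lambda>k. 0) = 0" by (simp add: bsum_def)
  have sub: "triangle_led v \<subseteq> {S \<in> transversals \<P>. v \<in> S \<and> indeg S v = 1}"
    using triangle_led_indeg by (auto simp: triangle_led_def)
  have "card (triangle_led v) \<le> card {S \<in> transversals \<P>. v \<in> S \<and> indeg S v = 1}"
    by (rule card_mono[OF _ sub]) (use finite_transversals_P in auto)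
  then have le: "card (triangle_led v) \<le> 4 ^ p * bsum n (\<lambda>k. if k + p = 1 then 1 else 0)"
    unfolding cnt .
  consider "p = 0" | "p = 1" | "p \<ge> 2" by linarith
  then show ?thesis
  proof cases
    case 1 then show ?thesis by (simp add: cnt z)
  next
    case 2 then show ?thesis using le z zero by (simp add: cnt)
  next
    case 3
    then have "bsum n (\<lambda>k. if k + p = 1 then 1 else 0) = 0" by (simp add: bsum_def)
    then show ?thesis using le 3 zero by (simp add: cnt)
  qed
qed

text \<open>
  If \<open>v\<close> is a source of some transversal, every \<open>S \<in> triangle_led v\<close> arises from it by exchanging a
  single vertex \<open>z\<close> for its partner \<open>w\<close>. Two or more such exchanges force some other
  out-neighbour of \<open>v\<close> to have too large an in-degree.
\<close>

definition exchange :: "'a \<Rightarrow> 'a \<Rightarrow> 'a \<Rightarrow> 'a \<Rightarrow> bool" where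
  "exchange v w u z \<longleftrightarrow> (w, v) \<in> E \<and> (v, u) \<in> E \<and> (v, z) \<in> E \<and> u \<noteq> z \<and> {w, z} \<in> \<P> \<and> (u, w) \<in> E \<and>
     {u, w} \<times> ({x. (v, x) \<in> E} - {u, z}) \<subseteq> E"

lemma source_out_neighbours:
  assumes S: "S \<in> transversals \<P>" "v \<in> S" "indeg S v = 0"
  shows "S - {v} = {x. (v, x) \<in> E}"
proof -
  have fS: "finite S" using finite_transversal[OF S(1)] .
  have v: "v \<in> V" using S transversal_subset by blast
  have "S \<inter> {u. (u, v) \<in> E} = {}" using S(3) fS by (simp add: indeg_def)
  then have "S - {v} \<subseteq> {x. (v, x) \<in> E}" using transversal_orient[OF S(1)] S(2) by blast
  moreover have "finite {x. (v, x) \<in> E}" using arcs_V by (intro finite_subset[OF _ finite_V]) auto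
  moreover have "card (S - {v}) = card {x. (v, x) \<in> E}"
    using out_card[OF v] card_transversal[OF S(1)] S(2) fS by simp
  \<comment> \<open>Both sets have \<open>c - 1\<close> elements, so the inclusion is an equality; a
    transversal with source \<open>v\<close> is therefore unique.\<close>
  ultimately show ?thesis by (simp add: card_subset_eq)
qed

text \<open>The in-neighbour \<open>w\<close> of \<open>v\<close> is missing from \<open>S0\<close>,
  so its partner \<open>z\<close> belongs to \<open>S0\<close>. Since \<open>w\<close> is the only
  in-neighbour of \<open>v\<close> in \<open>S\<close>, all other vertices of \<open>S\<close> are
  out-neighbours and hence remain from \<open>S0\<close>.\<close>

lemma triangle_led_exchange:
  assumes S0: "S0 \<in> transversals \<P>" "v \<in> S0" "indeg S0 v = 0" and S: "S \<in> triangle_led v"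
  obtains w u z where "exchange v w u z" "S = insert v (insert w ({x. (v, x) \<in> E} - {z}))"
proof -
  let ?Z = "{x. (v, x) \<in> E}"
  have Z: "S0 - {v} = ?Z" by (rule source_out_neighbours[OF S0])
  have v: "v \<in> V" using S0 transversal_subset by blast
  have fZ: "finite ?Z" using arcs_V by (intro finite_subset[OF _ finite_V]) auto
  obtain u w where T: "S \<in> transversals \<P>" "v \<in> S" "u \<in> S" "w \<in> S" "(v, u) \<in> E" "(u, w) \<in> E" "(w, v) \<in> E"
    "{v, u, w} \<times> (S - {v, u, w}) \<subseteq> E"
    using S by (auto simp: triangle_led_def)
  obtain P where P: "P \<in> \<P>" "w \<in> P" using T(7) arcs_V Union_P by blast
  have "card (S0 \<inter> P) = 1" using S0(1) P(1) by (simp add: transversals_def)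
  then obtain z where z: "S0 \<inter> P = {z}" by (auto simp: card_1_singleton_iff)
  have wnv: "w \<noteq> v" using T(7) no_loop by auto
  have "w \<notin> S0" using Z T(7) no_digon wnv by blast
  then have wz: "w \<noteq> z" using z by auto
  have "{w, z} = P"
  proof (rule card_seteq)
    show "finite P" using card_part[OF P(1)] by (simp add: card_ge_0_finite)
  qed (use z P card_part[OF P(1)] wz in auto)
  then have wzP: "{w, z} \<in> \<P>" using P by simp
  have "z \<noteq> v" using no_inner[OF wzP, of w v] T(7) by auto
  then have zZ: "z \<in> ?Z" using z Z by blast
  have zS: "z \<notin> S"
  proof
    assume "z \<in> S"
    then have "S \<inter> {w, z} = {w, z}" using T(4) by auto
    moreover have "card (S \<inter> {w, z}) = 1" using T(1) wzP by (simp add: transversals_def)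
    ultimately show False using wz by simp
  qed
  have sub: "S - {v, w} \<subseteq> ?Z - {z}"
  proof
    fix x assume "x \<in> S - {v, w}"
    then show "x \<in> ?Z - {z}" using T zS by (cases "x = u") auto
  qed
  have "card (S - {v, w}) = c - 2"
    using card_transversal[OF T(1)] T(2,4) wnv by (simp add: card_Diff_subset)
  moreover have "card (?Z - {z}) = c - 2" using out_card[OF v] zZ fZ by simp
  ultimately have eq: "S - {v, w} = ?Z - {z}" using sub fZ by (intro card_subset_eq) auto
  have Seq: "S = insert v (insert w (?Z - {z}))" using eq T(2,4) by blast
  have uz: "u \<noteq> z" using T(3) zS by auto
  have "?Z - {u, z} = S - {v, u, w}" using eq by blast
  then have "{u, w} \<times> (?Z - {u, z}) \<subseteq> E" using T(8) by blast
  then have "exchange v w u z"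
    unfolding exchange_def using T(5,6,7) zZ uz wzP by auto
  then show thesis using that Seq by blast
qed

text \<open>\<open>w\<close> and \<open>z\<close> are the two vertices of one partite set, and they
  cannot change roles between exchanges because one is an in-neighbour and the other an
  out-neighbour of \<open>v\<close>.\<close>

lemma exchange_eq_iff:
  assumes "exchange v w u z" "exchange v w' u' z'"
  shows "w = w' \<longleftrightarrow> z = z'"
proof -
  have *: "{w, z} \<in> \<P>" "{w', z'} \<in> \<P>" "w \<noteq> z'" "w' \<noteq> z" "w \<noteq> z" "w' \<noteq> z'"
    using assms no_digon by (auto simp: exchange_def)
  have same: "{w, z} = {w', z'}" if "{w, z} \<inter> {w', z'} \<noteq> {}"
  proof (rule ccontr)
    assume "{w, z} \<noteq> {w', z'}"
    from disjoint_P[unfolded disjoint_def, rule_format, OF *(1,2) this] that show False by simp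
  qed
  show ?thesis
  proof
    assume "w = w'"
    then show "z = z'" using same * by (auto simp: doubleton_eq_iff)
  next
    assume "z = z'"
    then show "w = w'" using same * by (auto simp: doubleton_eq_iff)
  qed
qed

text \<open>If \<open>u = u'\<close>, this vertex dominates \<open>w\<close>, \<open>w'\<close> and
  all other out-neighbours of \<open>v\<close>, since \<open>z\<close> and \<open>z'\<close> differ;
  its out-degree would be at least \<open>c\<close>. If neither \<open>u = z'\<close> nor
  \<open>u' = z\<close>, each of \<open>u\<close> and \<open>u'\<close> would dominate the
  other.\<close>

lemma exchange_pair:
  assumes v: "v \<in> V" and S0: "S0 \<in> transversals \<P>" "v \<in> S0" "indeg S0 v = 0"
    and ex: "exchange v w u z" "exchange v w' u' z'" and ne: "w \<noteq> w'" and c: "c \<ge> 2"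
  shows "u \<noteq> u'" "u = z' \<or> u' = z"
proof -
  let ?Z = "{x. (v, x) \<in> E}"
  have Z: "S0 - {v} = ?Z" by (rule source_out_neighbours[OF S0])
  have zz: "z \<noteq> z'" using exchange_eq_iff[OF ex] ne by blast
  have fin: "finite {x. (y, x) \<in> E}" for y using arcs_V by (intro finite_subset[OF _ finite_V]) auto
  show uu: "u \<noteq> u'"
  proof
    assume u: "u = u'"
    have uV: "u \<in> V" using ex arcs_V by (auto simp: exchange_def)
    have "insert w (insert w' (?Z - {u})) \<subseteq> {x. (u, x) \<in> E}"
      using ex u zz by (auto simp: exchange_def)
    then have "card (insert w (insert w' (?Z - {u}))) \<le> c - 1"
      using card_mono[OF fin[of u]] out_card[OF uV] by metis
    moreover have "w \<notin> ?Z" "w' \<notin> ?Z" "u \<in> ?Z" using ex no_digon by (auto simp: exchange_def)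
    then have "card (insert w (insert w' (?Z - {u}))) = c - 2 + 2"
      using ne fin[of v] out_card[OF v] by simp
    ultimately show False using c by simp
  qed
  show "u = z' \<or> u' = z"
  proof (rule ccontr)
    assume "\<not> ?thesis"
    then have "(u, u') \<in> E" "(u', u) \<in> E" using ex uu by (auto simp: exchange_def)
    then show False using no_digon by blast
  qed
qed

text \<open>By \<open>exchange_pair\<close> the vertices \<open>u\<close>, \<open>u'\<close>,
  \<open>z\<close>, \<open>z'\<close> cover at most three of the five out-neighbours of
  \<open>v\<close>. Of two others, one dominates the other, which then has the six in-neighbours
  \<open>v\<close>, \<open>u\<close>, \<open>u'\<close>, \<open>w\<close>, \<open>w'\<close> and
  that vertex, one more than allowed.\<close>

lemma exchange_unique:
  assumes c: "c = 6" and v: "v \<in> V" and S0: "S0 \<in> transversals \<P>" "v \<in> S0" "indeg S0 v = 0"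
    and ex: "exchange v w u z" "exchange v w' u' z'"
  shows "w = w'"
proof (rule ccontr)
  assume ne: "w \<noteq> w'"
  let ?Z = "{x. (v, x) \<in> E}"
  have Z: "S0 - {v} = ?Z" by (rule source_out_neighbours[OF S0])
  have c2: "c \<ge> 2" using c by simp
  note pair = exchange_pair[OF v S0 ex ne c2]
  have fin: "finite {x. (y, x) \<in> E}" "finite {x. (x, y) \<in> E}" for y
    using arcs_V by (auto intro: finite_subset[OF _ finite_V])
  have sub: "{u, u', z, z'} \<subseteq> ?Z" using ex by (auto simp: exchange_def)
  have "card {u, u', z, z'} \<le> 3"
  proof -
    have "{u, u', z, z'} \<subseteq> {u, u', z} \<or> {u, u', z, z'} \<subseteq> {u, u', z'}" using pair(2) by auto
    then show ?thesis
      using card_mono[of "{u, u', z}" "{u, u', z, z'}"] card_mono[of "{u, u', z'}" "{u, u', z, z'}"]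
        card_insert_le_m1[of 3 "{u', z}" u] card_insert_le_m1[of 3 "{u', z'}" u]
        card_insert_le_m1[of 2 "{z}" u'] card_insert_le_m1[of 2 "{z'}" u'] by fastforce
  qed
  moreover have "card ?Z = 5" using out_card[OF v] c by simp
  ultimately have "card (?Z - {u, u', z, z'}) \<ge> 2"
    using card_Diff_subset[OF _ sub] by simp
  then obtain k l where kl: "k \<in> ?Z - {u, u', z, z'}" "l \<in> ?Z - {u, u', z, z'}" "k \<noteq> l"
    by (metis One_nat_def Suc_1 card_le_Suc0_iff_eq finite_Diff fin(1) not_less_eq_eq)
  have False if kl: "k \<in> ?Z - {u, u', z, z'}" "l \<in> ?Z - {u, u', z, z'}" "(k, l) \<in> E" for k l
  proof -
    have "{v, u, u', w, w', k} \<subseteq> {x. (x, l) \<in> E}" using ex kl by (auto simp: exchange_def)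
    then have "card {v, u, u', w, w', k} \<le> 5"
      using card_mono[OF fin(2)[of l]] in_card[of l] kl arcs_V c by fastforce
    moreover have "w \<notin> ?Z" "w' \<notin> ?Z" "v \<notin> ?Z" "w \<noteq> v" "w' \<noteq> v"
      using ex no_digon no_loop by (auto simp: exchange_def)
    then have "card {v, u, u', w, w', k} = 6"
      using ne pair(1) kl sub by (subst card_insert_disjoint; auto)+
    ultimately show False by simp
  qed
  moreover have "(k, l) \<in> E \<or> (l, k) \<in> E"
    using transversal_orient[OF S0(1), of k l] kl Z by blast
  ultimately show False using kl by blast
qed

text \<open>Some out-neighbour \<open>l\<close> of \<open>v\<close> avoids all the
  \<open>z\<close>'s and, as shown below, all the \<open>u\<close>'s. It is dominated by
  \<open>v\<close> and by all three \<open>u\<close>'s and \<open>w\<close>'s: seven in-neighbours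
  instead of six.\<close>

lemma no_three_exchanges:
  assumes c: "c = 7" and v: "v \<in> V" and S0: "S0 \<in> transversals \<P>" "v \<in> S0" "indeg S0 v = 0"
    and ex: "exchange v w1 u1 z1" "exchange v w2 u2 z2" "exchange v w3 u3 z3"
    and ne: "w1 \<noteq> w2" "w1 \<noteq> w3" "w2 \<noteq> w3"
  shows False
proof -
  let ?Z = "{x. (v, x) \<in> E}"
  have c2: "c \<ge> 2" using c by simp
  note p12 = exchange_pair[OF v S0 ex(1,2) ne(1) c2] and p13 = exchange_pair[OF v S0 ex(1,3) ne(2) c2]
    and p23 = exchange_pair[OF v S0 ex(2,3) ne(3) c2]
  have fin: "finite {x. (y, x) \<in> E}" "finite {x. (x, y) \<in> E}" for y
    using arcs_V by (auto intro: finite_subset[OF _ finite_V])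
  have zs: "z1 \<noteq> z2" "z1 \<noteq> z3" "z2 \<noteq> z3"
    using exchange_eq_iff[OF ex(1,2)] exchange_eq_iff[OF ex(1,3)] exchange_eq_iff[OF ex(2,3)] ne by auto
  \<comment> \<open>Each pair of exchanges equates the \<open>u\<close> of one with the
    \<open>z\<close> of the other. As the \<open>z\<close>'s are distinct, no \<open>u\<close>
    serves two pairs, so the three pairs account for all three \<open>u\<close>'s.\<close>
  have us: "{u1, u2, u3} \<subseteq> {z1, z2, z3}" using p12 p13 p23 zs by auto
  have "card ?Z = 6" using out_card[OF v] c by simp
  moreover have "card {z1, z2, z3} \<le> 3" by (simp add: card_insert_if)
  ultimately have "\<not> ?Z \<subseteq> {z1, z2, z3}" using card_mono[of "{z1, z2, z3}" ?Z] by auto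
  then obtain l where l: "l \<in> ?Z" "l \<notin> {z1, z2, z3}" by blast
  then have lu: "l \<notin> {u1, u2, u3}" using us by blast
  have "{v, u1, u2, u3, w1, w2, w3} \<subseteq> {x. (x, l) \<in> E}" using ex l lu by (auto simp: exchange_def)
  then have "card {v, u1, u2, u3, w1, w2, w3} \<le> 6"
    using card_mono[OF fin(2)[of l]] in_card[of l] l arcs_V c by fastforce
  moreover have "w1 \<notin> ?Z" "w2 \<notin> ?Z" "w3 \<notin> ?Z" "v \<notin> ?Z" "w1 \<noteq> v" "w2 \<noteq> v" "w3 \<noteq> v"
    "u1 \<in> ?Z" "u2 \<in> ?Z" "u3 \<in> ?Z"
    using ex no_digon no_loop by (auto simp: exchange_def)
  then have "card {v, u1, u2, u3, w1, w2, w3} = 7"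
    using ne p12(1) p13(1) p23(1) by (subst card_insert_disjoint; auto)+
  ultimately show False by simp
qed

text \<open>A member of \<open>triangle_led v\<close> is determined by its exchanged pair, hence by
  \<open>w\<close> alone, so the bounds on exchanges with distinct \<open>w\<close> carry
  over.\<close>

lemma card_triangle_led_le:
  assumes v: "v \<in> V" and S0: "S0 \<in> transversals \<P>" "v \<in> S0" "indeg S0 v = 0"
  shows "c = 6 \<Longrightarrow> card (triangle_led v) \<le> 1" "c = 7 \<Longrightarrow> card (triangle_led v) \<le> 2"
proof -
  have fin: "finite (triangle_led v)"
    using finite_transversals_P by (simp add: triangle_led_def)
  {
    assume c: "c = 6"
    have "S = T" if ST: "S \<in> triangle_led v" "T \<in> triangle_led v" for S T
    proof -
      obtain w u z where S: "exchange v w u z" "S = insert v (insert w ({x. (v, x) \<in> E} - {z}))"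
        by (rule triangle_led_exchange[OF S0 ST(1)])
      obtain w' u' z' where T: "exchange v w' u' z'" "T = insert v (insert w' ({x. (v, x) \<in> E} - {z'}))"
        by (rule triangle_led_exchange[OF S0 ST(2)])
      show ?thesis using exchange_unique[OF c v S0 S(1) T(1)] exchange_eq_iff[OF S(1) T(1)] S T by simp
    qed
    then show "card (triangle_led v) \<le> 1" using card_le_Suc0_iff_eq[OF fin] by simp
  }
  {
    assume c: "c = 7"
    show "card (triangle_led v) \<le> 2"
    proof (rule ccontr)
      assume "\<not> ?thesis"
      then obtain X where "X \<subseteq> triangle_led v" "card X = 3"
        using obtain_subset_with_card_n[of 3 "triangle_led v"] by auto
      then obtain S T U where STU: "S \<in> triangle_led v" "T \<in> triangle_led v" "U \<in> triangle_led v"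
        "S \<noteq> T" "S \<noteq> U" "T \<noteq> U"
        by (auto simp: card_3_iff)
      obtain w1 u1 z1 where S: "exchange v w1 u1 z1" "S = insert v (insert w1 ({x. (v, x) \<in> E} - {z1}))"
        by (rule triangle_led_exchange[OF S0 STU(1)])
      obtain w2 u2 z2 where T: "exchange v w2 u2 z2" "T = insert v (insert w2 ({x. (v, x) \<in> E} - {z2}))"
        by (rule triangle_led_exchange[OF S0 STU(2)])
      obtain w3 u3 z3 where U: "exchange v w3 u3 z3" "U = insert v (insert w3 ({x. (v, x) \<in> E} - {z3}))"
        by (rule triangle_led_exchange[OF S0 STU(3)])
      show False
      proof (rule no_three_exchanges[OF c v S0 S(1) T(1) U(1)])
        show "w1 \<noteq> w2" using exchange_eq_iff[OF S(1) T(1)] S T STU by auto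
        show "w1 \<noteq> w3" using exchange_eq_iff[OF S(1) U(1)] S U STU by auto
        show "w2 \<noteq> w3" using exchange_eq_iff[OF T(1) U(1)] T U STU by auto
      qed
    qed
  }
qed

text \<open>A source earns 3 and each vertex of a leading triangle earns 1, so both outcomes of
  \<open>source_or_triangle_led\<close> are worth 3.\<close>

definition source_weight :: "'a \<Rightarrow> 'a set \<Rightarrow> nat" where
  "source_weight v S = (if indeg S v = 0 then 3 else 0)"

definition triangle_weight :: "'a \<Rightarrow> 'a set \<Rightarrow> nat" where
  "triangle_weight v S = (if S \<in> triangle_led v then 1 else 0)"

lemma sum_source_weight:
  "(\<Sum>S\<in>{S \<in> transversals \<P>. v \<in> S}. source_weight v S)
    = 3 * card {S \<in> transversals \<P>. v \<in> S \<and> indeg S v = 0}"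
proof -
  let ?T = "{S \<in> transversals \<P>. v \<in> S}"
  have "(\<Sum>S\<in>?T. source_weight v S) = (\<Sum>S\<in>{S \<in> ?T. indeg S v = 0}. 3)"
    unfolding source_weight_def using finite_transversals_P by (subst sum.inter_filter) auto
  also have "{S \<in> ?T. indeg S v = 0} = {S \<in> transversals \<P>. v \<in> S \<and> indeg S v = 0}" by auto
  finally show ?thesis by simp
qed

lemma sum_triangle_weight:
  "(\<Sum>S\<in>{S \<in> transversals \<P>. v \<in> S}. triangle_weight v S) = card (triangle_led v)"
proof -
  let ?T = "{S \<in> transversals \<P>. v \<in> S}"
  have "(\<Sum>S\<in>?T. triangle_weight v S) = (\<Sum>S\<in>{S \<in> ?T. S \<in> triangle_led v}. 1)"
    unfolding triangle_weight_def using finite_transversals_P by (subst sum.inter_filter) auto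
  also have "{S \<in> ?T. S \<in> triangle_led v} = triangle_led v" by (auto simp: triangle_led_def)
  finally show ?thesis by simp
qed

text \<open>If \<open>v\<close> is never a source, the bound is \<open>4 \<le> c - 2\<close>.
  Otherwise it is a source once, for weight 3, and the triangles add at most
  \<open>c - 5\<close>.\<close>

lemma sum_weights_le:
  assumes v: "v \<in> V" and c: "c \<in> {6, 7}"
  shows "(\<Sum>S\<in>{S \<in> transversals \<P>. v \<in> S}. source_weight v S + triangle_weight v S) \<le> c - 2"
proof (cases "card {S \<in> transversals \<P>. v \<in> S \<and> indeg S v = 0} = 0")
  case True
  then show ?thesis
    using card_sources_le[OF v] c by (auto simp: sum.distrib sum_source_weight sum_triangle_weight)
next
  case False
  then obtain S0 where "S0 \<in> transversals \<P>" "v \<in> S0" "indeg S0 v = 0"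
    by (metis (mono_tags, lifting) card.empty empty_Collect_eq)
  then show ?thesis
    using card_triangle_led_le[OF v] card_sources_le[OF v] c
    by (fastforce simp: sum.distrib sum_source_weight sum_triangle_weight)
qed

lemma sum_source_triangle_ge:
  assumes S: "S \<in> transversals \<P>" and A: "A \<noteq> {}" "A \<subseteq> S" "A \<times> (S - A) \<subseteq> E"
  shows "card A \<le> 3 \<Longrightarrow> 3 \<le> (\<Sum>v\<in>S. source_weight v S + triangle_weight v S)"
    and "card A \<le> 2 \<Longrightarrow> 3 \<le> (\<Sum>v\<in>S. source_weight v S)"
proof -
  have fS: "finite S" using finite_transversal[OF S] .
  have src: "3 \<le> (\<Sum>v\<in>S. source_weight v S)" if "x \<in> A" "indeg S x = 0" for x
    using member_le_sum[of x S "\<lambda>v. source_weight v S"] that A(2) fS by (auto simp: source_weight_def)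
  show "3 \<le> (\<Sum>v\<in>S. source_weight v S)" if "card A \<le> 2"
    using source_or_triangle_led[OF S A] that src by auto
  show "3 \<le> (\<Sum>v\<in>S. source_weight v S + triangle_weight v S)" if a: "card A \<le> 3"
    using source_or_triangle_led[OF S A a]
  proof
    assume "\<exists>v\<in>A. indeg S v = 0"
    then show ?thesis using src by (fastforce simp: sum.distrib)
  next
    assume "card A = 3 \<and> (\<forall>v\<in>A. S \<in> triangle_led v)"
    then have "3 = (\<Sum>v\<in>A. triangle_weight v S)" by (simp add: triangle_weight_def)
    also have "\<dots> \<le> (\<Sum>v\<in>S. triangle_weight v S)" by (rule sum_mono2) (use fS A in auto)
    finally show ?thesis by (simp add: sum.distrib)
  qed
qed

lemma nonstrongE:
  assumes "S \<in> nonstrong"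
  obtains A where "S \<in> transversals \<P>" "A \<noteq> {}" "A \<subseteq> S" "A \<times> (S - A) \<subseteq> E" "S - A \<noteq> {}"
    "card A + card (S - A) = c"
proof -
  obtain A where S: "S \<in> transversals \<P>" and A: "A \<noteq> {}" "A \<subset> S" "A \<times> (S - A) \<subseteq> E"
    using assms by (auto simp: nonstrong_def)
  have fS: "finite S" using finite_transversal[OF S] .
  then have "card A + card (S - A) = c"
    using A(2) card_transversal[OF S] card_Diff_subset[of A S] card_mono[of S A] finite_subset[of A S] by auto
  then show thesis using that[OF S A(1) _ A(3)] A(2) by blast
qed

end

context balanced_tournament
begin

interpretation rev: balanced_tournament V \<P> "E\<inverse>" c
  rewrites "balanced_tournament.nonstrong \<P> (E\<inverse>) = nonstrong"
  by (rule converse) (rule nonstrong_converse)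

lemma strong_transversals_small:
  assumes c: "c \<in> {6, 7}"
  shows "\<exists>S\<in>transversals \<P>. S \<notin> nonstrong \<and> V - S \<notin> nonstrong"
proof (cases "c = 6")
  case True
  \<comment> \<open>Triangles are weighted in one direction only: if \<open>A\<close> has more than
    three vertices, \<open>S - A\<close> has at most two and contains a sink of \<open>S\<close>.
    Thus \<open>K = 4 + 3\<close> and 84 < 96; triangles in both directions would give
    \<open>K = 8\<close> and only equality.\<close>
  show ?thesis
  proof (rule strong_transversals_exist[where M = 3 and K = 7
        and w = "\<lambda>v S. (source_weight v S + triangle_weight v S) + rev.source_weight v S"])
    fix S assume "S \<in> nonstrong"
    then obtain A where S: "S \<in> transversals \<P>" and A: "A \<noteq> {}" "A \<subseteq> S" "A \<times> (S - A) \<subseteq> E" "S - A \<noteq> {}"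
      "card A + card (S - A) = c"
      by (rule nonstrongE)
    show "3 \<le> (\<Sum>v\<in>S. source_weight v S + triangle_weight v S + rev.source_weight v S)"
    proof (cases "card A \<le> 3")
      case True
      then show ?thesis using sum_source_triangle_ge(1)[OF S A(1-3)] by (simp add: sum.distrib)
    next
      case False
      have "S - (S - A) = A" using A(2) by blast
      then have "(S - A) \<times> (S - (S - A)) \<subseteq> E\<inverse>" using A(3) by auto
      moreover have "card (S - A) \<le> 2" using False A(5) \<open>c = 6\<close> by linarith
      ultimately show ?thesis using rev.sum_source_triangle_ge(2)[OF S A(4)] by (simp add: sum.distrib)
    qed
  next
    fix v assume v: "v \<in> V"
    show "(\<Sum>S\<in>{S \<in> transversals \<P>. v \<in> S}. source_weight v S + triangle_weight v S + rev.source_weight v S) \<le> 7"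
      using sum_weights_le[OF v c] rev.card_sources_le[OF v] \<open>c = 6\<close>
      by (simp add: sum.distrib rev.sum_source_weight)
  qed (use True in simp_all)
next
  case False
  then have c7: "c = 7" using c by simp
  \<comment> \<open>Now the smaller side may have three vertices in either direction, so
    \<open>K = 5 + 5\<close>, and 140 < 192 suffices.\<close>
  show ?thesis
  proof (rule strong_transversals_exist[where M = 3 and K = 10 and w = "\<lambda>v S.
        (source_weight v S + triangle_weight v S) + (rev.source_weight v S + rev.triangle_weight v S)"])
    fix S assume "S \<in> nonstrong"
    then obtain A where S: "S \<in> transversals \<P>" and A: "A \<noteq> {}" "A \<subseteq> S" "A \<times> (S - A) \<subseteq> E" "S - A \<noteq> {}"
      "card A + card (S - A) = c"
      by (rule nonstrongE)
    show "3 \<le> (\<Sum>v\<in>S. source_weight v S + triangle_weight v S + (rev.source_weight v S + rev.triangle_weight v S))"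
    proof (cases "card A \<le> 3")
      case True
      then show ?thesis using sum_source_triangle_ge(1)[OF S A(1-3)] by (simp add: sum.distrib)
    next
      case False
      have "S - (S - A) = A" using A(2) by blast
      then have "(S - A) \<times> (S - (S - A)) \<subseteq> E\<inverse>" using A(3) by auto
      moreover have "card (S - A) \<le> 3" using False A(5) c7 by linarith
      ultimately show ?thesis using rev.sum_source_triangle_ge(1)[OF S A(4)] by (simp add: sum.distrib)
    qed
  next
    fix v assume v: "v \<in> V"
    show "(\<Sum>S\<in>{S \<in> transversals \<P>. v \<in> S}.
        source_weight v S + triangle_weight v S + (rev.source_weight v S + rev.triangle_weight v S)) \<le> 10"
      using sum_weights_le[OF v c] rev.sum_weights_le[OF v c] c7 by (simp add: sum.distrib)
  qed (use c7 in simp_all)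
qed

lemma strong_transversals:
  assumes "c \<ge> 6"
  shows "\<exists>S\<in>transversals \<P>. S \<notin> nonstrong \<and> V - S \<notin> nonstrong"
proof (cases "c \<ge> 8")
  case False
  then have "c \<in> {6, 7}" using assms by auto
  then show ?thesis by (rule strong_transversals_small)
qed (rule strong_transversals_large)

end

section \<open>Strong partitions\<close>

lemma in_degree_with_proj: "in_degree (with_proj D) v = card {u. (u, v) \<in> parcs D}"
proof -
  have "in_arcs (with_proj D) v = (\<lambda>u. (u, v)) ` {u. (u, v) \<in> parcs D}"
    by (auto simp: in_arcs_def)
  then show ?thesis by (simp add: in_degree_def card_image inj_on_def)
qed

lemma out_degree_with_proj: "out_degree (with_proj D) v = card {u. (v, u) \<in> parcs D}"
proof -
  have "out_arcs (with_proj D) v = (\<lambda>u. (v, u)) ` {u. (v, u) \<in> parcs D}"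
    by (auto simp: out_arcs_def)
  then show ?thesis by (simp add: out_degree_def card_image inj_on_def)
qed

lemma regular_balanced_multipartite_tournament_2D:
  assumes "regular_balanced_multipartite_tournament 2 c D \<P>"
  shows "balanced_tournament (pverts D) \<P> (parcs D) c"
proof -
  have D: "pair_digraph D" "partition_on (pverts D) \<P>" "card \<P> = c"
    and inner: "\<And>P u v. P \<in> \<P> \<Longrightarrow> u \<in> P \<Longrightarrow> v \<in> P \<Longrightarrow> (u, v) \<notin> parcs D"
    and orient: "\<And>P Q u v. P \<in> \<P> \<Longrightarrow> Q \<in> \<P> \<Longrightarrow> P \<noteq> Q \<Longrightarrow> u \<in> P \<Longrightarrow> v \<in> Q \<Longrightarrow>
      (u, v) \<in> parcs D \<longleftrightarrow> (v, u) \<notin> parcs D"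
    and two: "\<And>P. P \<in> \<P> \<Longrightarrow> card P = 2" and reg: "regular D"
    using assms
    unfolding regular_balanced_multipartite_tournament_def multipartite_tournament_def balanced_def
    by blast+
  interpret pair_digraph D by (rule D(1))
  have fin: "finite (pverts D)" by simp
  have arcs: "parcs D \<subseteq> pverts D \<times> pverts D" using in_arcsD1 in_arcsD2 by auto
  have U: "\<Union>\<P> = pverts D" and disj: "disjoint \<P>" using D(2) by (auto simp: partition_on_def)
  have "card (\<Union>\<P>) = (\<Sum>P\<in>\<P>. card P)"
    by (rule card_Union_disjoint) (use disj two card_ge_0_finite in \<open>force+\<close>)
  then have cV: "card (pverts D) = 2 * c" using U two D(3) by simp
  have degs: "card {u. (u, v) \<in> parcs D} = c - 1 \<and> card {u. (v, u) \<in> parcs D} = c - 1"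
    if v: "v \<in> pverts D" for v
  proof -
    obtain P where P: "P \<in> \<P>" "v \<in> P" using U v by blast
    have "u \<in> pverts D - P \<longleftrightarrow> (u, v) \<in> parcs D \<or> (v, u) \<in> parcs D" for u
    proof
      assume "u \<in> pverts D - P"
      then obtain Q where "Q \<in> \<P>" "u \<in> Q" "Q \<noteq> P" using U by blast
      then show "(u, v) \<in> parcs D \<or> (v, u) \<in> parcs D" using orient P by blast
    next
      assume "(u, v) \<in> parcs D \<or> (v, u) \<in> parcs D"
      then show "u \<in> pverts D - P" using inner P arcs by blast
    qed
    then have un: "pverts D - P = {u. (u, v) \<in> parcs D} \<union> {u. (v, u) \<in> parcs D}" by blast
    have "finite {u. (u, v) \<in> parcs D}" "finite {u. (v, u) \<in> parcs D}"
      using arcs by (auto intro: finite_subset[OF _ fin])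
    moreover have "{u. (u, v) \<in> parcs D} \<inter> {u. (v, u) \<in> parcs D} = {}"
    proof (rule ccontr)
      assume "\<not> ?thesis"
      then obtain u where u: "(u, v) \<in> parcs D" "(v, u) \<in> parcs D" by blast
      then obtain Q where "Q \<in> \<P>" "u \<in> Q" using U arcs by blast
      then show False using orient[of Q P u v] inner[of P u v] P u by blast
    qed
    ultimately have "card {u. (u, v) \<in> parcs D} + card {u. (v, u) \<in> parcs D} = card (pverts D - P)"
      unfolding un by (rule card_Un_disjoint[symmetric])
    also have "\<dots> = 2 * c - 2"
    proof -
      have "P \<subseteq> pverts D" using P U by blast
      then show ?thesis using cV two[OF P(1)] fin by (simp add: card_Diff_subset finite_subset)
    qed
    finally show ?thesis
      using reg v by (simp add: regular_def in_degree_with_proj out_degree_with_proj)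
  qed
  show ?thesis
  proof (rule balanced_tournament.intro)
    show "(u, v) \<in> parcs D \<longleftrightarrow> (v, u) \<notin> parcs D"
      if "P \<in> \<P>" "Q \<in> \<P>" "P \<noteq> Q" "u \<in> P" "v \<in> Q" for P Q u v
      by (rule orient[OF that])
  qed (simp_all add: fin D two inner arcs degs)
qed

context balanced_tournament
begin

definition induced :: "'a set \<Rightarrow> 'a pair_pre_digraph" where
  "induced S = \<lparr>pverts = S, parcs = E \<inter> S \<times> S\<rparr>"

lemma pair_digraph_induced:
  assumes "S \<in> transversals \<P>"
  shows "pair_digraph (induced S)"
proof
  show "finite (pverts (induced S))" "finite (parcs (induced S))"
    using finite_transversal[OF assms] by (auto simp: induced_def)
  fix e assume "e \<in> parcs (induced S)"
  then have e: "e \<in> E" "e \<in> S \<times> S" by (simp_all add: induced_def)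
  then show "fst e \<in> pverts (induced S)" "snd e \<in> pverts (induced S)" by (auto simp: induced_def)
  show "fst e \<noteq> snd e" using e(1) no_loop by (cases e) auto
qed

lemma tournament_induced:
  assumes "S \<in> transversals \<P>"
  shows "tournament (induced S)"
  unfolding tournament_def
proof (intro conjI ballI impI)
  show "pair_digraph (induced S)" by (rule pair_digraph_induced[OF assms])
  fix u v assume "u \<in> pverts (induced S)" "v \<in> pverts (induced S)" "u \<noteq> v"
  then have uv: "u \<in> S" "v \<in> S" "u \<noteq> v" by (simp_all add: induced_def)
  then show "(u, v) \<in> parcs (induced S) \<longleftrightarrow> (v, u) \<notin> parcs (induced S)"
    using transversal_orient[OF assms uv] by (auto simp: induced_def)
qed

text \<open>No arc leaves the set \<open>R\<close> of vertices reachable from \<open>u\<close>. In a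
  tournament all arcs between \<open>S - R\<close> and \<open>R\<close> then point into
  \<open>R\<close>, so \<open>S - R\<close> witnesses that \<open>S\<close> is nonstrong.\<close>

lemma strongly_connected_induced:
  assumes S: "S \<in> transversals \<P>" "S \<notin> nonstrong" and ne: "S \<noteq> {}"
  shows "strongly_connected (with_proj (induced S))"
proof (rule ccontr)
  assume "\<not> ?thesis"
  then obtain u v where uv: "u \<in> S" "v \<in> S" "(u, v) \<notin> rtrancl_on S (E \<inter> S \<times> S)"
    using ne by (auto simp: strongly_connected_def reachable_def induced_def)
  define R where "R = {x. (u, x) \<in> rtrancl_on S (E \<inter> S \<times> S)}"
  have RS: "R \<subseteq> S" using in_rtrancl_on_in_F by (fastforce simp: R_def)
  have u: "u \<in> R" "v \<notin> R" using uv by (auto simp: R_def)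
  have closed: "(x, y) \<notin> E" if "x \<in> R" "y \<in> S - R" for x y
    using that RS rtrancl_on_into_rtrancl_on[of u x S "E \<inter> S \<times> S" y] by (auto simp: R_def)
  have "(y, x) \<in> E" if "y \<in> S - R" "x \<in> R" for x y
    using closed[OF that(2,1)] transversal_orient[OF S(1), of y x] that RS by auto
  then have "(S - R) \<times> (S - (S - R)) \<subseteq> E" by auto
  moreover have "S - R \<noteq> {}" "S - R \<subset> S" using u uv RS by auto
  ultimately have "\<exists>A. A \<noteq> {} \<and> A \<subset> S \<and> A \<times> (S - A) \<subseteq> E" by (intro exI[of _ "S - R"]) simp
  then have "S \<in> nonstrong" unfolding nonstrong_def using S(1) by simp
  then show False using S(2) by simp
qed

end

lemma strong_partition_exists:
  assumes D: "regular_balanced_multipartite_tournament 2 c D \<P>" and c: "c \<ge> 6"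
  shows "\<exists>\<T>. strong_partition 2 c D \<P> \<T>"
proof -
  interpret balanced_tournament "pverts D" \<P> "parcs D" c
    by (rule regular_balanced_multipartite_tournament_2D[OF D])
  have pD: "pair_digraph D"
    using D by (simp add: regular_balanced_multipartite_tournament_def multipartite_tournament_def)
  obtain S where S: "S \<in> transversals \<P>" "S \<notin> nonstrong" "pverts D - S \<notin> nonstrong"
    using strong_transversals[OF c] by blast
  define S' where "S' = pverts D - S"
  have S': "S' \<in> transversals \<P>" "S' \<notin> nonstrong"
    using transversal_complement[OF S(1)] S(3) by (simp_all add: S'_def)
  have ne: "T \<noteq> {}" if "T \<in> transversals \<P>" for T using card_transversal[OF that] c by auto
  have disj: "S \<inter> S' = {}" and un: "S \<union> S' = pverts D"
    using transversal_subset[OF S(1)] by (auto simp: S'_def)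
  have neq: "induced S \<noteq> induced S'" using disj ne[OF S(1)] by (auto simp: induced_def)
  have sub: "subgraph (with_proj (induced T)) (with_proj D)" if T: "T \<in> transversals \<P>" for T
  proof -
    interpret T: pair_digraph "induced T" by (rule pair_digraph_induced[OF T])
    interpret D: pair_digraph D by (rule pD)
    show ?thesis
      unfolding subgraph_def compatible_def using transversal_subset[OF T] T.wf_digraph D.wf_digraph
      by (auto simp: induced_def)
  qed
  have all: "subgraph (with_proj T) (with_proj D) \<and> tournament T \<and> card (pverts T) = c \<and>
      (\<forall>P\<in>\<P>. card (pverts T \<inter> P) = 1) \<and> strongly_connected (with_proj T)"
    if T: "T \<in> {induced S, induced S'}" for T
  proof -
    obtain X where X: "T = induced X" "X \<in> transversals \<P>" "X \<notin> nonstrong"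
      using T S(1,2) S' by (cases "T = induced S") auto
    have "pverts T = X" by (simp add: X(1) induced_def)
    moreover have "\<forall>P\<in>\<P>. card (X \<inter> P) = 1" using X(2) by (simp add: transversals_def)
    ultimately show ?thesis
      using sub[OF X(2)] tournament_induced[OF X(2)] strongly_connected_induced[OF X(2,3) ne[OF X(2)]]
        card_transversal[OF X(2)] X(1) by simp
  qed
  have "strong_partition 2 c D \<P> {induced S, induced S'}"
    unfolding strong_partition_def max_tournament_partition_def
  proof (intro conjI)
    show "card {induced S, induced S'} = 2" using neq by simp
    show "\<forall>T\<in>{induced S, induced S'}. subgraph (with_proj T) (with_proj D) \<and> tournament T \<and>
        card (pverts T) = c \<and> (\<forall>P\<in>\<P>. card (pverts T \<inter> P) = 1)"
      "\<forall>T\<in>{induced S, induced S'}. strongly_connected (with_proj T)"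
      using all by simp_all
    show "\<forall>A\<in>{induced S, induced S'}. \<forall>B\<in>{induced S, induced S'}. A \<noteq> B \<longrightarrow> pverts A \<inter> pverts B = {}"
      using disj by (auto simp: induced_def)
    show "(\<Union>T\<in>{induced S, induced S'}. pverts T) = pverts D"
      using un by (simp add: induced_def)
  qed
  then show ?thesis ..
qed

section \<open>A digraph with five partite sets\<close>

text \<open>
  For any two complementary transversals of this digraph, one of them has a source or a sink.
\<close>

definition example_arcs :: "(nat \<times> nat) list" where
  "example_arcs =
    [(0, 4), (0, 5), (0, 6), (0, 7), (1, 2), (1, 3), (1, 8), (1, 9),
     (2, 0), (2, 4), (2, 7), (2, 9), (3, 0), (3, 5), (3, 6), (3, 8),
     (4, 1), (4, 3), (4, 6), (4, 9), (5, 1), (5, 2), (5, 7), (5, 8),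
     (6, 1), (6, 2), (6, 5), (6, 9), (7, 1), (7, 3), (7, 4), (7, 8),
     (8, 0), (8, 2), (8, 4), (8, 6), (9, 0), (9, 3), (9, 5), (9, 7)]"

definition example_digraph :: "nat pair_pre_digraph" where
  "example_digraph = \<lparr>pverts = {0, 1, 2, 3, 4, 5, 6, 7, 8, 9}, parcs = set example_arcs\<rparr>"

definition example_parts :: "nat set set" where
  "example_parts = {{0, 1}, {2, 3}, {4, 5}, {6, 7}, {8, 9}}"

lemma example_regular: "regular example_digraph"
proof -
  have d: "distinct example_arcs" by (simp add: example_arcs_def)
  have "card {u. (u, v) \<in> set example_arcs} = length (filter (\<lambda>e. snd e = v) example_arcs)"
    "card {u. (v, u) \<in> set example_arcs} = length (filter (\<lambda>e. fst e = v) example_arcs)" for v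
  proof -
    have "{e \<in> set example_arcs. snd e = v} = (\<lambda>u. (u, v)) ` {u. (u, v) \<in> set example_arcs}"
      "{e \<in> set example_arcs. fst e = v} = (\<lambda>u. (v, u)) ` {u. (v, u) \<in> set example_arcs}"
      by force+
    then show "card {u. (u, v) \<in> set example_arcs} = length (filter (\<lambda>e. snd e = v) example_arcs)"
      "card {u. (v, u) \<in> set example_arcs} = length (filter (\<lambda>e. fst e = v) example_arcs)"
      using distinct_card[OF distinct_filter[OF d, of "\<lambda>e. snd e = v"]]
        distinct_card[OF distinct_filter[OF d, of "\<lambda>e. fst e = v"]]
      by (simp_all add: card_image inj_on_def)
  qed
  note cards = this
  have "\<forall>v\<in>{0, 1, 2, 3, 4, 5, 6, 7, 8, 9}. length (filter (\<lambda>e. snd e = v) example_arcs)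
      = length (filter (\<lambda>e. fst e = v) example_arcs)"
    by (simp add: example_arcs_def)
  then show ?thesis
    by (simp only: regular_def in_degree_with_proj out_degree_with_proj example_digraph_def
        pair_pre_digraph.simps cards)
qed

lemma example_regular_balanced: "regular_balanced_multipartite_tournament 2 5 example_digraph example_parts"
  unfolding regular_balanced_multipartite_tournament_def multipartite_tournament_def
proof (intro conjI)
  show "pair_digraph example_digraph"
    by unfold_locales (auto simp: example_digraph_def example_arcs_def)
  show "partition_on (pverts example_digraph) example_parts"
    by (auto simp: partition_on_def disjoint_def example_digraph_def example_parts_def)
  show "card example_parts = 5"
    by (simp add: example_parts_def doubleton_eq_iff)
  show "\<forall>P\<in>example_parts. \<forall>u\<in>P. \<forall>v\<in>P. (u, v) \<notin> parcs example_digraph"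
    by (simp add: example_parts_def example_digraph_def example_arcs_def)
  show "\<forall>P\<in>example_parts. \<forall>Q\<in>example_parts. P \<noteq> Q \<longrightarrow>
      (\<forall>u\<in>P. \<forall>v\<in>Q. (u, v) \<in> parcs example_digraph \<longleftrightarrow> (v, u) \<notin> parcs example_digraph)"
    by (simp add: example_parts_def example_digraph_def example_arcs_def)
  show "balanced 2 example_parts" by (simp add: balanced_def example_parts_def)
  show "regular example_digraph" by (rule example_regular)
qed simp

text \<open>The last arc of a walk from \<open>x\<close> to \<open>v\<close> and the first arc of a
  walk back: a strong tournament with at least two vertices has neither a source nor a sink.\<close>

lemma strongly_connected_neighbours:
  assumes T: "strongly_connected (with_proj T)" and xv: "v \<in> pverts T" "x \<in> pverts T" "x \<noteq> v"
    and arcs: "parcs T \<subseteq> pverts T \<times> pverts T"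
  shows "(\<exists>u\<in>pverts T. (u, v) \<in> parcs T) \<and> (\<exists>u\<in>pverts T. (v, u) \<in> parcs T)"
proof -
  have "(x, v) \<in> rtrancl_on (pverts T) (parcs T)" "(v, x) \<in> rtrancl_on (pverts T) (parcs T)"
    using T xv by (auto simp: strongly_connected_def reachable_def)
  then show ?thesis
    using xv arcs by (auto elim: rtrancl_on.cases converse_rtrancl_on_cases)
qed

text \<open>Replaces the quantifiers by membership atoms, so that the absence of sources and sinks
  becomes propositional.\<close>

lemma example_neighbours:
  "(\<exists>u\<in>X. (u, 0) \<in> set example_arcs) \<longleftrightarrow> 2 \<in> X \<or> 3 \<in> X \<or> 8 \<in> X \<or> 9 \<in> X"
  "(\<exists>u\<in>X. (0, u) \<in> set example_arcs) \<longleftrightarrow> 4 \<in> X \<or> 5 \<in> X \<or> 6 \<in> X \<or> 7 \<in> X"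
  "(\<exists>u\<in>X. (u, 1) \<in> set example_arcs) \<longleftrightarrow> 4 \<in> X \<or> 5 \<in> X \<or> 6 \<in> X \<or> 7 \<in> X"
  "(\<exists>u\<in>X. (1, u) \<in> set example_arcs) \<longleftrightarrow> 2 \<in> X \<or> 3 \<in> X \<or> 8 \<in> X \<or> 9 \<in> X"
  "(\<exists>u\<in>X. (u, 2) \<in> set example_arcs) \<longleftrightarrow> 1 \<in> X \<or> 5 \<in> X \<or> 6 \<in> X \<or> 8 \<in> X"
  "(\<exists>u\<in>X. (2, u) \<in> set example_arcs) \<longleftrightarrow> 0 \<in> X \<or> 4 \<in> X \<or> 7 \<in> X \<or> 9 \<in> X"
  "(\<exists>u\<in>X. (u, 3) \<in> set example_arcs) \<longleftrightarrow> 1 \<in> X \<or> 4 \<in> X \<or> 7 \<in> X \<or> 9 \<in> X"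
  "(\<exists>u\<in>X. (3, u) \<in> set example_arcs) \<longleftrightarrow> 0 \<in> X \<or> 5 \<in> X \<or> 6 \<in> X \<or> 8 \<in> X"
  "(\<exists>u\<in>X. (u, 4) \<in> set example_arcs) \<longleftrightarrow> 0 \<in> X \<or> 2 \<in> X \<or> 7 \<in> X \<or> 8 \<in> X"
  "(\<exists>u\<in>X. (4, u) \<in> set example_arcs) \<longleftrightarrow> 1 \<in> X \<or> 3 \<in> X \<or> 6 \<in> X \<or> 9 \<in> X"
  "(\<exists>u\<in>X. (u, 5) \<in> set example_arcs) \<longleftrightarrow> 0 \<in> X \<or> 3 \<in> X \<or> 6 \<in> X \<or> 9 \<in> X"
  "(\<exists>u\<in>X. (5, u) \<in> set example_arcs) \<longleftrightarrow> 1 \<in> X \<or> 2 \<in> X \<or> 7 \<in> X \<or> 8 \<in> X"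
  "(\<exists>u\<in>X. (u, 6) \<in> set example_arcs) \<longleftrightarrow> 0 \<in> X \<or> 3 \<in> X \<or> 4 \<in> X \<or> 8 \<in> X"
  "(\<exists>u\<in>X. (6, u) \<in> set example_arcs) \<longleftrightarrow> 1 \<in> X \<or> 2 \<in> X \<or> 5 \<in> X \<or> 9 \<in> X"
  "(\<exists>u\<in>X. (u, 7) \<in> set example_arcs) \<longleftrightarrow> 0 \<in> X \<or> 2 \<in> X \<or> 5 \<in> X \<or> 9 \<in> X"
  "(\<exists>u\<in>X. (7, u) \<in> set example_arcs) \<longleftrightarrow> 1 \<in> X \<or> 3 \<in> X \<or> 4 \<in> X \<or> 8 \<in> X"
  "(\<exists>u\<in>X. (u, 8) \<in> set example_arcs) \<longleftrightarrow> 1 \<in> X \<or> 3 \<in> X \<or> 5 \<in> X \<or> 7 \<in> X"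
  "(\<exists>u\<in>X. (8, u) \<in> set example_arcs) \<longleftrightarrow> 0 \<in> X \<or> 2 \<in> X \<or> 4 \<in> X \<or> 6 \<in> X"
  "(\<exists>u\<in>X. (u, 9) \<in> set example_arcs) \<longleftrightarrow> 1 \<in> X \<or> 2 \<in> X \<or> 4 \<in> X \<or> 6 \<in> X"
  "(\<exists>u\<in>X. (9, u) \<in> set example_arcs) \<longleftrightarrow> 0 \<in> X \<or> 3 \<in> X \<or> 5 \<in> X \<or> 7 \<in> X"
  by (auto simp: example_arcs_def)

lemma example_no_strong_pair:
  assumes one: "\<And>P. P \<in> example_parts \<Longrightarrow> card (S \<inter> P) = 1"
    and T: "T = {0, 1, 2, 3, 4, 5, 6, 7, 8, 9} - S"
    and S: "\<And>v. v \<in> S \<Longrightarrow> (\<exists>u\<in>S. (u, v) \<in> set example_arcs) \<and> (\<exists>u\<in>S. (v, u) \<in> set example_arcs)"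
    and S': "\<And>v. v \<in> T \<Longrightarrow> (\<exists>u\<in>T. (u, v) \<in> set example_arcs) \<and> (\<exists>u\<in>T. (v, u) \<in> set example_arcs)"
  shows False
proof -
  have one_iff: "a \<in> S \<longleftrightarrow> b \<notin> S" if "{a, b} \<in> example_parts" "a \<noteq> b" for a b
    using one[OF that(1)] that(2) by (cases "a \<in> S"; cases "b \<in> S") simp_all
  have m: "(1 :: nat) \<in> S \<longleftrightarrow> 0 \<notin> S" "(3 :: nat) \<in> S \<longleftrightarrow> 2 \<notin> S" "(5 :: nat) \<in> S \<longleftrightarrow> 4 \<notin> S"
    "(7 :: nat) \<in> S \<longleftrightarrow> 6 \<notin> S" "(9 :: nat) \<in> S \<longleftrightarrow> 8 \<notin> S"
    using one_iff[of 0 1] one_iff[of 2 3] one_iff[of 4 5] one_iff[of 6 7] one_iff[of 8 9]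
    by (auto simp: example_parts_def)
  have t: "(0 :: nat) \<in> T \<longleftrightarrow> 0 \<notin> S" "(1 :: nat) \<in> T \<longleftrightarrow> 0 \<in> S" "(2 :: nat) \<in> T \<longleftrightarrow> 2 \<notin> S" "(3 :: nat) \<in> T \<longleftrightarrow> 2 \<in> S"
    "(4 :: nat) \<in> T \<longleftrightarrow> 4 \<notin> S" "(5 :: nat) \<in> T \<longleftrightarrow> 4 \<in> S" "(6 :: nat) \<in> T \<longleftrightarrow> 6 \<notin> S" "(7 :: nat) \<in> T \<longleftrightarrow> 6 \<in> S"
    "(8 :: nat) \<in> T \<longleftrightarrow> 8 \<notin> S" "(9 :: nat) \<in> T \<longleftrightarrow> 8 \<in> S"
    unfolding T using m by auto
  note nb = S[of 0] S[of 1] S[of 2] S[of 3] S[of 4] S[of 5] S[of 6] S[of 7] S[of 8] S[of 9]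
    S'[of 0] S'[of 1] S'[of 2] S'[of 3] S'[of 4] S'[of 5] S'[of 6] S'[of 7] S'[of 8] S'[of 9]
  \<comment> \<open>By \<open>m\<close> and \<open>t\<close> everything is expressed through
    membership of 0, 2, 4, 6 and 8 in \<open>S\<close>; the conditions are unsatisfiable in these
    five Boolean variables.\<close>
  show False using nb unfolding example_neighbours m t by sat
qed

lemma example_no_strong_partition: "\<not> strong_partition 2 5 example_digraph example_parts \<T>"
proof
  assume sp: "strong_partition 2 5 example_digraph example_parts \<T>"
  then have "card \<T> = 2" by (simp add: strong_partition_def max_tournament_partition_def)
  then obtain A B where AB: "\<T> = {A, B}" "A \<noteq> B" by (auto simp: card_2_iff)
  have P: "card (pverts X) = 5" "\<And>P. P \<in> example_parts \<Longrightarrow> card (pverts X \<inter> P) = 1"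
    "strongly_connected (with_proj X)" "parcs X \<subseteq> set example_arcs" "parcs X \<subseteq> pverts X \<times> pverts X"
    if X: "X \<in> \<T>" for X
  proof -
    have sub: "subgraph (with_proj X) (with_proj example_digraph)" and "pair_digraph X"
      and "card (pverts X) = 5" "\<forall>P\<in>example_parts. card (pverts X \<inter> P) = 1" "strongly_connected (with_proj X)"
      using sp X by (auto simp: strong_partition_def max_tournament_partition_def tournament_def)
    then interpret pair_digraph X by simp
    show "parcs X \<subseteq> pverts X \<times> pverts X" using in_arcsD1 in_arcsD2 by auto
    show "parcs X \<subseteq> set example_arcs" using sub by (simp add: subgraph_def example_digraph_def)
    show "card (pverts X) = 5" "strongly_connected (with_proj X)" by fact+
    show "card (pverts X \<inter> P) = 1" if "P \<in> example_parts" for P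
      using that \<open>\<forall>P\<in>example_parts. card (pverts X \<inter> P) = 1\<close> by blast
  qed
  have disj: "pverts A \<inter> pverts B = {}" and un: "pverts A \<union> pverts B = {0, 1, 2, 3, 4, 5, 6, 7, 8, 9}"
    using sp AB by (auto simp: strong_partition_def max_tournament_partition_def example_digraph_def)
  have nb: "(\<exists>u\<in>pverts X. (u, v) \<in> set example_arcs) \<and> (\<exists>u\<in>pverts X. (v, u) \<in> set example_arcs)"
    if X: "X \<in> \<T>" and v: "v \<in> pverts X" for X v
  proof -
    have "\<not> pverts X \<subseteq> {v}" using P(1)[OF X] card_mono[of "{v}" "pverts X"] by auto
    then obtain x where "x \<in> pverts X" "x \<noteq> v" by blast
    then show ?thesis
      using strongly_connected_neighbours[OF P(3)[OF X] v _ _ P(5)[OF X]] P(4)[OF X] by blast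
  qed
  show False
  proof (rule example_no_strong_pair[of "pverts A" "pverts B"])
    show "pverts B = {0, 1, 2, 3, 4, 5, 6, 7, 8, 9} - pverts A" using disj un by blast
  qed (use P(2) nb AB in auto)
qed

theorem theorem1p2:
  shows "ST 2 = 6 \<and>
    (\<forall>c\<ge>6. \<forall>(D :: 'a pair_pre_digraph) \<P>.
       regular_balanced_multipartite_tournament 2 c D \<P> \<longrightarrow> (\<exists>\<T>. strong_partition 2 c D \<P> \<T>)) \<and>
    (\<exists>(D :: nat pair_pre_digraph) \<P>.
       regular_balanced_multipartite_tournament 2 5 D \<P> \<and> \<not> (\<exists>\<T>. strong_partition 2 5 D \<P> \<T>))"
proof (intro conjI)
  show "ST 2 = 6"
    unfolding ST_def
  proof (rule Least_equality)
    fix c' :: nat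
    assume c': "c' \<ge> 3 \<and> (\<forall>c\<ge>c'. \<forall>(D :: nat pair_pre_digraph) \<P>.
        regular_balanced_multipartite_tournament 2 c D \<P> \<longrightarrow> (\<exists>\<T>. strong_partition 2 c D \<P> \<T>))"
    show "6 \<le> c'"
    proof (rule ccontr)
      assume "\<not> 6 \<le> c'"
      then have "c' \<le> 5" by simp
      then have "\<exists>\<T>. strong_partition 2 5 example_digraph example_parts \<T>"
        using c' example_regular_balanced by blast
      then show False using example_no_strong_partition by blast
    qed
  qed (use strong_partition_exists in auto)
  show "\<forall>c\<ge>6. \<forall>(D :: 'a pair_pre_digraph) \<P>.
      regular_balanced_multipartite_tournament 2 c D \<P> \<longrightarrow> (\<exists>\<T>. strong_partition 2 c D \<P> \<T>)"
    using strong_partition_exists by blast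
  show "\<exists>(D :: nat pair_pre_digraph) \<P>.
      regular_balanced_multipartite_tournament 2 5 D \<P> \<and> \<not> (\<exists>\<T>. strong_partition 2 5 D \<P> \<T>)"
    using example_regular_balanced example_no_strong_partition by blast
qed

end
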